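(* Let $\varphi$ be a Musielak–Orlicz function. Then for every $r\in(0,1]$, $H^s_\varphi(\Omega)=H^{\varphi,\infty,s}_{\mathrm{at},r}(\Omega)$ with equivalent quasi-norms.
   Context: Let $(\Omega,\mathcal F,\mathbb P)$ be a probability space, $(\mathcal F_n)_{n\in\mathbb Z_+}$ a nondecreasing sequence of sub-$\sigma$-algebras, $\mathbb E_n$ the conditional expectations. A Musielak–Orlicz function is $\varphi:\Omega\times[0,\infty)\to[0,\infty)$ with $\varphi(x,\cdot)$ nondecreasing, $\varphi(x,0)=0$, $\lim_{t\to\infty}\varphi(x,t)=\infty$ for each $x$, $\varphi(\cdot,t)$ measurable for each $t$; $\|f\|_{L^\varphi(\Omega)}:=\inf\{\lambda>0:\int_\Omega\varphi(x,|f|/\lambda)\,d\mathbb P\le1\}$. $\mathcal M$ is the set of martingales $f=(f_n)_{n\in\mathbb Z_+}$ w.r.t. $(\mathcal F_n)$ with $f_0=0$; $d_nf:=f_n-f_{n-1}$; $s(f):=(\sum_{i\ge1}\mathbb E_{i-1}|d_if|^2)^{1/2}$; $H^s_\varphi(\Omega):=\{f\in\mathcal M:\|f\|_{H^s_\varphi}:=\|s(f)\|_{L^\varphi(\Omega)}<\infty\}$. For a stopping time $\nu$, $B_\nu:=\{\nu<\infty\}$. A measurable function $a$ is a $(\varphi,\infty)_s$-atom if there is a stopping time $\nu$ with (i) $a_n:=\mathbb E_na=0$ whenever $\nu\ge n$, and (ii) $\|s(a)\|_{L^\infty(B_\nu)}\le\|\mathbf 1_{B_\nu}\|_{L^\varphi(\Omega)}^{-1}$.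 For $r>0$, $H^{\varphi,\infty,s}_{\mathrm{at},r}(\Omega)$ is the set of $f\in\mathcal M$ for which there exist nonnegative reals $(\mu^k)_{k\in\mathbb Z}$ and $(\varphi,\infty)_s$-atoms $a^k$ with associated stopping times $\nu^k$ such that $f_n=\sum_{k\in\mathbb Z}\mu^ka^k_n$ for all $n\in\mathbb Z_+$ and $\big\|\{\sum_{k}[\mu^k\mathbf 1_{B_{\nu^k}}/\|\mathbf 1_{B_{\nu^k}}\|_{L^\varphi(\Omega)}]^r\}^{1/r}\big\|_{L^\varphi(\Omega)}<\infty$; its quasi-norm is the infimum of this last quantity over all such decompositions. *)

theory Defs
  imports "HOL-Probability.Probability"
begin

definition epow :: "ennreal \<Rightarrow> real \<Rightarrow> ennreal" where
  "epow t p = (if t = \<infinity> then \<infinity> else ennreal (enn2real t powr p))"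

definition filtration_nat :: "'a measure \<Rightarrow> (nat \<Rightarrow> 'a measure) \<Rightarrow> bool" where
  "filtration_nat M F \<longleftrightarrow> (\<forall>n. subalgebra M (F n)) \<and> (\<forall>m n. m \<le> n \<longrightarrow> sets (F m) \<subseteq> sets (F n))"

definition musielak_orlicz :: "'a measure \<Rightarrow> ('a \<Rightarrow> real \<Rightarrow> real) \<Rightarrow> bool" where
  "musielak_orlicz M \<phi> \<longleftrightarrow>
     (\<forall>x\<in>space M. (\<forall>t\<ge>0. \<phi> x t \<ge> 0) \<and> mono_on {0..} (\<phi> x) \<and> \<phi> x 0 = 0
        \<and> filterlim (\<phi> x) at_top at_top)
   \<and> (\<forall>t\<ge>0. (\<lambda>x. \<phi> x t) \<in> borel_measurable M)"

definition Phi :: "('a \<Rightarrow> real \<Rightarrow> real) \<Rightarrow> 'a \<Rightarrow> ennreal \<Rightarrow> ennreal" where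
  "Phi \<phi> x t = (if t = \<infinity> then \<infinity> else ennreal (\<phi> x (enn2real t)))"

text \<open>Luxemburg (quasi-)norm of a nonnegative (possibly infinite) function;
  the infimum of the empty set is infinity.\<close>
definition lux :: "'a measure \<Rightarrow> ('a \<Rightarrow> real \<Rightarrow> real) \<Rightarrow> ('a \<Rightarrow> ennreal) \<Rightarrow> ennreal" where
  "lux M \<phi> g = Inf {ennreal l | l. l > 0 \<and> (\<integral>\<^sup>+ x. Phi \<phi> x (g x / ennreal l) \<partial>M) \<le> 1}"

definition martingale0 :: "'a measure \<Rightarrow> (nat \<Rightarrow> 'a measure) \<Rightarrow> (nat \<Rightarrow> 'a \<Rightarrow> real) \<Rightarrow> bool" where
  "martingale0 M F f \<longleftrightarrow>
     (\<forall>n. f n \<in> borel_measurable (F n) \<and> integrable M (f n))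
   \<and> (\<forall>n. AE x in M. real_cond_exp M (F n) (f (Suc n)) x = f n x)
   \<and> (AE x in M. f 0 x = 0)"

definition sfun :: "'a measure \<Rightarrow> (nat \<Rightarrow> 'a measure) \<Rightarrow> (nat \<Rightarrow> 'a \<Rightarrow> real) \<Rightarrow> 'a \<Rightarrow> ennreal" where
  "sfun M F f x = epow (\<Sum>i. nn_cond_exp M (F i) (\<lambda>y. ennreal ((f (Suc i) y - f i y)\<^sup>2)) x) (1/2)"

definition Hs_norm :: "'a measure \<Rightarrow> (nat \<Rightarrow> 'a measure) \<Rightarrow> ('a \<Rightarrow> real \<Rightarrow> real) \<Rightarrow> (nat \<Rightarrow> 'a \<Rightarrow> real) \<Rightarrow> ennreal" where
  "Hs_norm M F \<phi> f = lux M \<phi> (sfun M F f)"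

definition in_Hs :: "'a measure \<Rightarrow> (nat \<Rightarrow> 'a measure) \<Rightarrow> ('a \<Rightarrow> real \<Rightarrow> real) \<Rightarrow> (nat \<Rightarrow> 'a \<Rightarrow> real) \<Rightarrow> bool" where
  "in_Hs M F \<phi> f \<longleftrightarrow> martingale0 M F f \<and> Hs_norm M F \<phi> f < \<infinity>"

definition stopping_time_nat :: "'a measure \<Rightarrow> (nat \<Rightarrow> 'a measure) \<Rightarrow> ('a \<Rightarrow> enat) \<Rightarrow> bool" where
  "stopping_time_nat M F \<nu> \<longleftrightarrow> (\<forall>n. {x \<in> space M. \<nu> x \<le> enat n} \<in> sets (F n))"

definition Bset :: "'a measure \<Rightarrow> ('a \<Rightarrow> enat) \<Rightarrow> 'a set" where
  "Bset M \<nu> = {x \<in> space M. \<nu> x < \<infinity>}"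

definition is_atom :: "'a measure \<Rightarrow> (nat \<Rightarrow> 'a measure) \<Rightarrow> ('a \<Rightarrow> real \<Rightarrow> real) \<Rightarrow> ('a \<Rightarrow> real) \<Rightarrow> ('a \<Rightarrow> enat) \<Rightarrow> bool" where
  "is_atom M F \<phi> a \<nu> \<longleftrightarrow>
     a \<in> borel_measurable M \<and> integrable M a \<and> stopping_time_nat M F \<nu>
   \<and> (\<forall>n. AE x in M. enat n \<le> \<nu> x \<longrightarrow> real_cond_exp M (F n) a x = 0)
   \<and> (AE x in M. x \<in> Bset M \<nu> \<longrightarrow>
        sfun M F (\<lambda>n. real_cond_exp M (F n) a) x \<le> inverse (lux M \<phi> (indicator (Bset M \<nu>))))"

definition at_decomp :: "'a measure \<Rightarrow> (nat \<Rightarrow> 'a measure) \<Rightarrow> ('a \<Rightarrow> real \<Rightarrow> real) \<Rightarrow> (nat \<Rightarrow> 'a \<Rightarrow> real)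
    \<Rightarrow> (int \<Rightarrow> real) \<Rightarrow> (int \<Rightarrow> 'a \<Rightarrow> real) \<Rightarrow> (int \<Rightarrow> 'a \<Rightarrow> enat) \<Rightarrow> bool" where
  "at_decomp M F \<phi> f \<mu> a \<nu> \<longleftrightarrow>
     (\<forall>k. \<mu> k \<ge> 0 \<and> is_atom M F \<phi> (a k) (\<nu> k))
   \<and> (\<forall>n. AE x in M.
        (\<lambda>N::nat. \<Sum>k\<in>{- int N..int N}. \<mu> k * real_cond_exp M (F n) (a k) x) \<longlonglongrightarrow> f n x)"

definition at_value :: "'a measure \<Rightarrow> ('a \<Rightarrow> real \<Rightarrow> real) \<Rightarrow> real
    \<Rightarrow> (int \<Rightarrow> real) \<Rightarrow> (int \<Rightarrow> 'a \<Rightarrow> enat) \<Rightarrow> ennreal" where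
  "at_value M \<phi> r \<mu> \<nu> = lux M \<phi> (\<lambda>x. epow (\<integral>\<^sup>+ k. epow (ennreal (\<mu> k) * indicator (Bset M (\<nu> k)) x
        / lux M \<phi> (indicator (Bset M (\<nu> k)))) r \<partial>count_space UNIV) (1 / r))"

definition in_Hat :: "'a measure \<Rightarrow> (nat \<Rightarrow> 'a measure) \<Rightarrow> ('a \<Rightarrow> real \<Rightarrow> real) \<Rightarrow> real \<Rightarrow> (nat \<Rightarrow> 'a \<Rightarrow> real) \<Rightarrow> bool" where
  "in_Hat M F \<phi> r f \<longleftrightarrow> martingale0 M F f \<and>
     (\<exists>\<mu> a \<nu>. at_decomp M F \<phi> f \<mu> a \<nu> \<and> at_value M \<phi> r \<mu> \<nu> < \<infinity>)"

definition Hat_norm :: "'a measure \<Rightarrow> (nat \<Rightarrow> 'a measure) \<Rightarrow> ('a \<Rightarrow> real \<Rightarrow> real) \<Rightarrow> real \<Rightarrow> (nat \<Rightarrow> 'a \<Rightarrow> real) \<Rightarrow> ennreal" where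
  "Hat_norm M F \<phi> r f = Inf {at_value M \<phi> r \<mu> \<nu> | \<mu> a \<nu>. at_decomp M F \<phi> f \<mu> a \<nu>}"

end

theory Submission
  imports Defs
begin

text \<open>Given an atomic decomposition \<open>f = \<Sum>\<^sub>k \<mu>\<^sub>k a\<^sub>k\<close>, put \<open>c\<^sub>k = \<mu>\<^sub>k / \<parallel>1\<^sub>B\<parallel>\<close> with \<open>B = {\<nu>\<^sub>k < \<infinity>}\<close>. The increment
  \<open>d\<^sub>i\<^sub>+\<^sub>1 a\<^sub>k\<close> vanishes off \<open>{\<nu>\<^sub>k \<le> i}\<close>, so the Cauchy--Schwarz inequality with the weights \<open>c\<^sub>k 1{\<nu>\<^sub>k \<le> i}\<close>,
  conditioned on \<open>F\<^sub>i\<close> and summed over \<open>i\<close>, gives \<open>s(f) \<le> \<Sum>\<^sub>k c\<^sub>k 1\<^sub>B\<close>, which for \<open>r \<le> 1\<close> is at most the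
  \<open>\<ell>\<^sup>r\<close> expression in the atomic quasi-norm. Conversely, stop \<open>f\<close> when \<open>s\<^sub>n\<^sub>+\<^sub>1(f)\<close> first exceeds \<open>2\<^sup>k\<close>: the
  differences of consecutive stopped martingales have \<open>s \<le> 2\<^sup>k\<^sup>+\<^sup>1\<close>, hence are bounded in \<open>L\<^sup>2\<close> and closed by
  an integrable function, and they telescope to \<open>f\<close>. Here \<open>B = {s(f) > 2\<^sup>k}\<close>, so the atomic quasi-norm is
  controlled pointwise by a geometric series comparable to \<open>s(f)\<close>.\<close>

section \<open>Powers and sums of extended nonnegative reals\<close>

lemma epow_ennreal: "0 \<le> x \<Longrightarrow> epow (ennreal x) p = ennreal (x powr p)"
  by (simp add: epow_def)

lemma epow_top [simp]: "epow \<infinity> p = \<infinity>" "epow top p = top"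
  by (simp_all add: epow_def)

lemma epow_mono:
  assumes "s \<le> t" "0 \<le> p"
  shows "epow s p \<le> epow t p"
proof (cases t)
  case (real u)
  with assms obtain v where "s = ennreal v" "0 \<le> v"
    by (cases s) (auto simp: top_unique)
  with assms real show ?thesis
    by (auto simp: epow_ennreal intro!: ennreal_leI powr_mono2)
qed simp

lemma epow_epow:
  assumes "0 \<le> p"
  shows "epow (epow t p) q = epow t (p * q)"
  by (cases t) (auto simp: epow_ennreal powr_powr)

lemma epow_1 [simp]: "epow t 1 = t"
  by (cases t) (auto simp: epow_ennreal)

lemma epow_add:
  assumes "0 \<le> p" "0 \<le> q"
  shows "epow t (p + q) = epow t p * epow t q"
  by (cases t) (auto simp: epow_ennreal powr_add ennreal_mult ennreal_top_mult)

lemma epow_half_power2: "(epow t (1/2))\<^sup>2 = t"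
proof -
  have "(epow t (1/2))\<^sup>2 = epow t (1/2 + 1/2)"
    by (subst epow_add) (auto simp: power2_eq_square)
  then show ?thesis by simp
qed

lemma epow_power2_half: "epow (t\<^sup>2) (1/2) = t"
  by (cases t) (auto simp: ennreal_power epow_ennreal powr_half_sqrt)

lemma borel_measurable_epow [measurable]:
  assumes [measurable]: "g \<in> borel_measurable M"
  shows "(\<lambda>x. epow (g x) p) \<in> borel_measurable M"
  unfolding epow_def by measurable

text \<open>With \<open>S\<close> the sum of the \<open>u\<^sup>r\<close>, each term is at most \<open>S\<^sup>1\<^sup>/\<^sup>r\<close>, so \<open>u = u\<^sup>r u\<^sup>1\<^sup>-\<^sup>r\<close> is at
  most \<open>u\<^sup>r\<close> times the \<open>(1 - r)/r\<close>-th power of \<open>S\<close>.\<close>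
lemma nn_integral_count_space_le_epow:
  fixes u :: "'b \<Rightarrow> ennreal"
  assumes r: "0 < r" "r \<le> 1"
  shows "(\<integral>\<^sup>+ k. u k \<partial>count_space UNIV) \<le> epow (\<integral>\<^sup>+ k. epow (u k) r \<partial>count_space UNIV) (1 / r)"
proof -
  define S where "S = (\<integral>\<^sup>+ k. epow (u k) r \<partial>count_space UNIV)"
  have "u k \<le> epow (u k) r * epow S ((1 - r) / r)" for k
  proof -
    have "epow (u k) r \<le> S"
      unfolding S_def by (rule nn_integral_ge_point) simp
    then have "epow (epow (u k) r) ((1 - r) / r) \<le> epow S ((1 - r) / r)"
      using r by (intro epow_mono) auto
    then have "epow (u k) (1 - r) \<le> epow S ((1 - r) / r)"
      using r by (simp add: epow_epow)
    moreover have "u k = epow (u k) r * epow (u k) (1 - r)"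
      using r epow_add[of r "1 - r" "u k"] by simp
    ultimately show ?thesis
      by (metis mult_left_mono zero_le)
  qed
  then have "(\<integral>\<^sup>+ k. u k \<partial>count_space UNIV) \<le> (\<integral>\<^sup>+ k. epow (u k) r * epow S ((1 - r) / r) \<partial>count_space UNIV)"
    by (intro nn_integral_mono)
  also have "\<dots> = epow S 1 * epow S ((1 - r) / r)"
    by (simp add: nn_integral_multc S_def)
  also have "\<dots> = epow S (1 / r)"
    using r by (subst epow_add[symmetric]) (auto simp: field_simps)
  finally show ?thesis unfolding S_def .
qed

text \<open>Factor \<open>\<bar>h k\<bar>\<close> as \<open>sqrt (b k)\<close> times
  \<open>\<bar>h k\<bar> / sqrt (b k)\<close> and apply Cauchy-Schwarz. Where
  \<open>b k = 0\<close>, the second hypothesis makes both sides of this factorisation 0.\<close>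

lemma weighted_Cauchy_Schwarz_count_space:
  fixes b h :: "'b \<Rightarrow> real"
  assumes "\<And>k. 0 \<le> b k" "\<And>k. b k = 0 \<Longrightarrow> h k = 0"
  shows "(\<integral>\<^sup>+ k. ennreal \<bar>h k\<bar> \<partial>count_space UNIV)\<^sup>2
    \<le> (\<integral>\<^sup>+ k. ennreal (b k) \<partial>count_space UNIV) * (\<integral>\<^sup>+ k. ennreal ((h k)\<^sup>2 / b k) \<partial>count_space UNIV)"
proof -
  let ?f = "\<lambda>k. ennreal (sqrt (b k))" and ?g = "\<lambda>k. ennreal (\<bar>h k\<bar> / sqrt (b k))"
  have "ennreal \<bar>h k\<bar> = ?f k * ?g k" for k
    using assms[of k] by (cases "b k = 0") (auto simp flip: ennreal_mult)
  moreover have "(?f k)\<^sup>2 = ennreal (b k)" "(?g k)\<^sup>2 = ennreal ((h k)\<^sup>2 / b k)" for k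
    using assms(1)[of k] by (auto simp: ennreal_power power_divide)
  ultimately show ?thesis
    using Cauchy_Schwarz_nn_integral[of ?f "count_space UNIV" ?g] by simp
qed

section \<open>The Luxemburg quasi-norm\<close>

lemma lux_mono_AE:
  assumes \<phi>: "musielak_orlicz M \<phi>" and "AE x in M. g x \<le> h x"
  shows "lux M \<phi> g \<le> lux M \<phi> h"
proof -
  have Phi_mono: "Phi \<phi> x s \<le> Phi \<phi> x t" if "x \<in> space M" "s \<le> t" for x s t
  proof (cases "t = \<infinity>")
    case False
    with \<open>s \<le> t\<close> have "s \<noteq> \<infinity>" by (auto simp: top_unique)
    moreover have "enn2real s \<le> enn2real t"
      using False \<open>s \<le> t\<close> by (intro enn2real_mono) (auto simp: less_top)
    moreover have "mono_on {0..} (\<phi> x)"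
      using \<phi> \<open>x \<in> space M\<close> by (auto simp: musielak_orlicz_def)
    ultimately show ?thesis
      using False by (auto simp: Phi_def mono_on_def intro!: ennreal_leI)
  qed (simp add: Phi_def)
  have "(\<integral>\<^sup>+ x. Phi \<phi> x (g x / ennreal l) \<partial>M) \<le> (\<integral>\<^sup>+ x. Phi \<phi> x (h x / ennreal l) \<partial>M)" for l
  proof (rule nn_integral_mono_AE)
    show "AE x in M. Phi \<phi> x (g x / ennreal l) \<le> Phi \<phi> x (h x / ennreal l)"
      using assms(2) AE_space by eventually_elim (auto intro!: Phi_mono divide_right_mono_ennreal)
  qed
  then show ?thesis
    unfolding lux_def by (intro Inf_superset_mono) (auto intro: order_trans)
qed

lemma lux_cmult_le:
  assumes "0 < c"
  shows "lux M \<phi> (\<lambda>x. ennreal c * g x) \<le> ennreal c * lux M \<phi> g"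
proof -
  let ?A = "\<lambda>g. {ennreal l | l. l > 0 \<and> (\<integral>\<^sup>+ x. Phi \<phi> x (g x / ennreal l) \<partial>M) \<le> 1}"
  \<comment> \<open>The factor c is moved to the left so that the infimum on the right can be tested
    one scale l at a time: if l is admissible for g, then \<open>c * l\<close> is admissible for the
    multiple of g.\<close>
  have "Inf (?A (\<lambda>x. ennreal c * g x)) / ennreal c \<le> Inf (?A g)"
  proof (rule Inf_greatest, clarify)
    fix l :: real assume l: "0 < l" "(\<integral>\<^sup>+ x. Phi \<phi> x (g x / ennreal l) \<partial>M) \<le> 1"
    have "ennreal c * t / ennreal (c * l) = t / ennreal l" for t
      using assms l divide_mult_eq[of "ennreal c" t "ennreal l"] by (simp add: ennreal_mult mult.commute)
    with l have "ennreal (c * l) \<in> ?A (\<lambda>x. ennreal c * g x)"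
      using assms by (intro CollectI exI[of _ "c * l"]) simp
    then have "Inf (?A (\<lambda>x. ennreal c * g x)) \<le> ennreal c * ennreal l"
      using assms l by (intro Inf_lower) (simp flip: ennreal_mult)
    then show "Inf (?A (\<lambda>x. ennreal c * g x)) / ennreal c \<le> ennreal l"
      using assms by (simp add: divide_le_posI_ennreal)
  qed
  then have "ennreal c * (Inf (?A (\<lambda>x. ennreal c * g x)) / ennreal c) \<le> ennreal c * Inf (?A g)"
    by (rule mult_left_mono) simp
  then show ?thesis
    using assms unfolding lux_def
    by (simp add: ennreal_times_divide mult_divide_eq_ennreal mult.commute[of "ennreal c"])
qed

text \<open>\<open>Phi\<close> sends infinity to infinity, so a set of positive measure on which g
  is infinite would make the modular infinite at every scale l.\<close>

lemma AE_finite_if_lux_finite: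
  assumes [measurable]: "g \<in> borel_measurable M" and fin: "lux M \<phi> g < \<infinity>"
  shows "AE x in M. g x < \<infinity>"
proof -
  obtain l where l: "0 < l" "(\<integral>\<^sup>+ x. Phi \<phi> x (g x / ennreal l) \<partial>M) \<le> 1"
    using fin unfolding lux_def Inf_less_iff by auto
  let ?B = "{x \<in> space M. g x = \<infinity>}"
  have "(\<integral>\<^sup>+ x. \<infinity> * indicator ?B x \<partial>M) \<le> (\<integral>\<^sup>+ x. Phi \<phi> x (g x / ennreal l) \<partial>M)"
    using l(1) by (intro nn_integral_mono) (auto simp: Phi_def ennreal_top_divide split: split_indicator)
  with l(2) have "(\<integral>\<^sup>+ x. \<infinity> * indicator ?B x \<partial>M) < \<infinity>"
    by (metis ennreal_one_less_top infinity_ennreal_def order.trans order_le_less_trans)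
  then have "emeasure M ?B = 0"
    by (subst (asm) nn_integral_cmult_indicator) (auto simp: ennreal_top_mult split: if_splits)
  then have "AE x in M. x \<notin> ?B"
    by (intro AE_not_in) (auto simp: null_sets_def)
  with AE_space show ?thesis by eventually_elim (auto simp: less_top)
qed

text \<open>Norm zero supplies admissible scales below 1/(n+1), so the integral of
  \<open>\<phi> x n\<close> over B is at most 1 for every n. As \<open>\<phi> x n\<close> tends to
  infinity, Fatou's lemma forces B to be null. This disposes of atoms whose size bound is
  \<open>inverse 0\<close>, that is, infinite.\<close>

lemma AE_notin_if_lux_indicator_zero:
  assumes \<phi>: "musielak_orlicz M \<phi>" and [measurable]: "B \<in> sets M"
    and zero: "lux M \<phi> (indicator B) = 0"
  shows "AE x in M. x \<notin> B"
proof -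
  have [measurable]: "(\<lambda>x. \<phi> x (real n)) \<in> borel_measurable M" for n
    using \<phi> by (simp add: musielak_orlicz_def)
  let ?u = "\<lambda>n x. ennreal (\<phi> x (real n)) * indicator B x"
  have le1: "(\<integral>\<^sup>+ x. ?u n x \<partial>M) \<le> 1" for n
  proof -
    have "lux M \<phi> (indicator B) < ennreal (1 / real (Suc n))"
      using zero by simp
    then obtain l where l: "0 < l" "l < 1 / real (Suc n)"
        "(\<integral>\<^sup>+ x. Phi \<phi> x (indicator B x / ennreal l) \<partial>M) \<le> 1"
      unfolding lux_def Inf_less_iff by (auto simp: ennreal_less_iff)
    have n_le: "real n \<le> 1 / l"
      using l(1,2) by (simp add: field_simps)
    have "(\<integral>\<^sup>+ x. ?u n x \<partial>M) \<le> (\<integral>\<^sup>+ x. Phi \<phi> x (indicator B x / ennreal l) \<partial>M)"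
    proof (intro nn_integral_mono)
      fix x assume "x \<in> space M"
      then have "\<phi> x (real n) \<le> \<phi> x (1 / l)"
        using \<phi> n_le l(1) by (auto simp: musielak_orlicz_def mono_on_def)
      moreover have "1 / ennreal l = ennreal (1 / l)"
        using l(1) by (metis divide_ennreal ennreal_1 zero_le_one)
      ultimately show "?u n x \<le> Phi \<phi> x (indicator B x / ennreal l)"
        using l(1) by (auto simp: Phi_def intro!: ennreal_leI split: split_indicator)
    qed
    with l(3) show ?thesis by (rule order_trans[rotated])
  qed
  have "(\<integral>\<^sup>+ x. liminf (\<lambda>n. ?u n x) \<partial>M) \<le> liminf (\<lambda>n. \<integral>\<^sup>+ x. ?u n x \<partial>M)"
    by (rule nn_integral_liminf) measurable
  also have "\<dots> \<le> liminf (\<lambda>n. 1)"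
    by (intro Liminf_mono always_eventually allI le1)
  finally have "(\<integral>\<^sup>+ x. liminf (\<lambda>n. ?u n x) \<partial>M) \<noteq> \<infinity>"
    by (auto simp: Liminf_const top_unique)
  then have "AE x in M. liminf (\<lambda>n. ?u n x) \<noteq> \<infinity>"
    by (intro nn_integral_noteq_infinite) auto
  with AE_space show ?thesis
  proof eventually_elim
    case (elim x)
    show ?case
    proof
      assume "x \<in> B"
      have "filterlim (\<lambda>n. \<phi> x (real n)) at_top sequentially"
        using \<phi> elim(1) filterlim_compose[OF _ filterlim_real_sequentially]
        by (auto simp: musielak_orlicz_def)
      then have "(\<lambda>n. ennreal (\<phi> x (real n))) \<longlonglongrightarrow> \<infinity>"
        by (simp add: ennreal_tendsto_top_eq_at_top)
      with \<open>x \<in> B\<close> elim(2) show False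
        by (simp add: lim_imp_Liminf)
    qed
  qed
qed

section \<open>From atomic decompositions to the conditional square function\<close>

text \<open>N is arbitrary, so that measurability can also be obtained with respect to the
  sub-sigma-algebras \<open>F i\<close>.\<close>

lemma borel_measurable_nn_integral_countable:
  fixes H :: "'b::countable \<Rightarrow> 'a \<Rightarrow> ennreal"
  assumes [measurable]: "\<And>k. H k \<in> borel_measurable N"
  shows "(\<lambda>x. \<integral>\<^sup>+ k. H k x \<partial>count_space UNIV) \<in> borel_measurable N"
proof (intro sigma_finite_measure.borel_measurable_nn_integral sigma_finite_measure_count_space)
  show "(\<lambda>(x, k). H k x) \<in> borel_measurable (N \<Otimes>\<^sub>M count_space UNIV)"
    by (subst measurable_pair_swap_iff, rule measurable_pair_measure_countable1) auto
qed

lemma enat_finite_iff_le: "\<nu> < \<infinity> \<longleftrightarrow> (\<exists>n. \<nu> \<le> enat n)"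
  by (cases \<nu>) auto

section \<open>Conditional expectations along a filtration\<close>

locale filtered_prob_space = prob_space M for M :: "'a measure" +
  fixes F :: "nat \<Rightarrow> 'a measure"
  assumes filtration: "filtration_nat M F"
begin

lemma subalgebra_F: "subalgebra M (F n)"
  using filtration by (simp add: filtration_nat_def)

lemma subalgebra_F_mono: "m \<le> n \<Longrightarrow> subalgebra (F n) (F m)"
  using filtration by (auto simp: filtration_nat_def subalgebra_def)

lemma space_F: "space (F n) = space M"
  using subalgebra_F[of n] by (simp add: subalgebra_def)

lemma measurable_F_M: "g \<in> measurable (F n) N \<Longrightarrow> g \<in> measurable M N"
  by (rule measurable_from_subalg[OF subalgebra_F])

lemma measurable_F_mono: "g \<in> measurable (F m) N \<Longrightarrow> m \<le> n \<Longrightarrow> g \<in> measurable (F n) N"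
  by (rule measurable_from_subalg[OF subalgebra_F_mono])

lemma sets_F_M: "A \<in> sets (F n) \<Longrightarrow> A \<in> sets M"
  using subalgebra_F[of n] by (auto simp: subalgebra_def)

sublocale F: sigma_finite_subalgebra M "F n" for n
  by (intro finite_measure_subalgebra_is_sigma_finite finite_measure_subalgebra.intro
      finite_measure_subalgebra_axioms.intro subalgebra_F) unfold_locales

text \<open>Both sides have the same integral over every set of \<open>F n\<close>: Tonelli moves
  the sum outside, and the defining property of conditional expectation applies term by
  term.\<close>

lemma nn_cond_exp_nn_integral_count_space:
  fixes G :: "'b::countable \<Rightarrow> 'a \<Rightarrow> ennreal"
  assumes G [measurable]: "\<And>k. G k \<in> borel_measurable M"
  shows "AE x in M. nn_cond_exp M (F n) (\<lambda>y. \<integral>\<^sup>+ k. G k y \<partial>count_space UNIV) x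
    = (\<integral>\<^sup>+ k. nn_cond_exp M (F n) (G k) x \<partial>count_space UNIV)"
proof -
  have "AE x in M. (\<integral>\<^sup>+ k. nn_cond_exp M (F n) (G k) x \<partial>count_space UNIV)
      = nn_cond_exp M (F n) (\<lambda>y. \<integral>\<^sup>+ k. G k y \<partial>count_space UNIV) x"
  proof (rule F.nn_cond_exp_charact)
    fix A assume A: "A \<in> sets (F n)"
    note [measurable] = A sets_F_M[OF A]
    have "(\<integral>\<^sup>+x\<in>A. (\<integral>\<^sup>+ k. G k x \<partial>count_space UNIV) \<partial>M)
      = (\<integral>\<^sup>+x. (\<integral>\<^sup>+ k. indicator A x * G k x \<partial>count_space UNIV) \<partial>M)"
      by (subst nn_integral_cmult) (auto simp: mult.commute)
    also have "\<dots> = (\<integral>\<^sup>+ k. (\<integral>\<^sup>+x. indicator A x * G k x \<partial>M) \<partial>count_space UNIV)"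
      by (intro nn_integral_count_space_nn_integral) auto
    also have "\<dots> = (\<integral>\<^sup>+ k. (\<integral>\<^sup>+x. indicator A x * nn_cond_exp M (F n) (G k) x \<partial>M) \<partial>count_space UNIV)"
      by (intro nn_integral_cong F.nn_cond_exp_intg[symmetric]) auto
    also have "\<dots> = (\<integral>\<^sup>+x. (\<integral>\<^sup>+ k. indicator A x * nn_cond_exp M (F n) (G k) x \<partial>count_space UNIV) \<partial>M)"
      by (intro nn_integral_count_space_nn_integral[symmetric]) auto
    also have "\<dots> = (\<integral>\<^sup>+x\<in>A. (\<integral>\<^sup>+ k. nn_cond_exp M (F n) (G k) x \<partial>count_space UNIV) \<partial>M)"
      by (subst nn_integral_cmult) (auto simp: mult.commute)
    finally show "(\<integral>\<^sup>+x\<in>A. (\<integral>\<^sup>+ k. G k x \<partial>count_space UNIV) \<partial>M)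
      = (\<integral>\<^sup>+x\<in>A. (\<integral>\<^sup>+ k. nn_cond_exp M (F n) (G k) x \<partial>count_space UNIV) \<partial>M)" .
  qed (auto intro!: borel_measurable_nn_integral_countable)
  then show ?thesis by eventually_elim simp
qed

text \<open>Over A, the function g and its conditional expectation have the same integral, and a
  nonnegative function with zero integral vanishes almost everywhere.\<close>

lemma AE_zero_if_nn_cond_exp_zero:
  assumes g [measurable]: "g \<in> borel_measurable M" and A: "A \<in> sets (F n)"
    and zero: "AE x in M. x \<in> A \<longrightarrow> nn_cond_exp M (F n) g x = 0"
  shows "AE x in M. x \<in> A \<longrightarrow> g x = 0"
proof -
  note [measurable] = A sets_F_M[OF A]
  have "(\<integral>\<^sup>+ x. indicator A x * g x \<partial>M) = (\<integral>\<^sup>+ x. indicator A x * nn_cond_exp M (F n) g x \<partial>M)"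
    by (rule F.nn_cond_exp_intg[symmetric]) auto
  also have "\<dots> = 0"
    by (subst nn_integral_0_iff_AE) (use zero in \<open>auto elim!: eventually_mono\<close>)
  finally have "AE x in M. indicator A x * g x = 0"
    by (subst (asm) nn_integral_0_iff_AE) auto
  then show ?thesis
    by eventually_elim (auto split: split_indicator)
qed

lemma Bset_in_sets:
  assumes "stopping_time_nat M F \<nu>"
  shows "Bset M \<nu> \<in> sets M"
proof -
  have "Bset M \<nu> = (\<Union>n. {x \<in> space M. \<nu> x \<le> enat n})"
    by (auto simp: Bset_def enat_finite_iff_le simp del: enat_ord_simps)
  also have "\<dots> \<in> sets M"
    using assms by (intro sets.countable_UN) (auto simp: stopping_time_nat_def intro: sets_F_M)
  finally show ?thesis .
qed

lemma sfun_power2: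
  "(sfun M F f x)\<^sup>2 = (\<Sum>i. nn_cond_exp M (F i) (\<lambda>y. ennreal ((f (Suc i) y - f i y)\<^sup>2)) x)"
  unfolding sfun_def by (rule epow_half_power2)

lemma borel_measurable_sfun [measurable]: "sfun M F f \<in> borel_measurable M"
  unfolding sfun_def by measurable

text \<open>The expansion converges along symmetric partial sums, perhaps not absolutely. Each
  partial sum is bounded by the full, possibly infinite, series of absolute values, and the bound
  passes to the limit.\<close>

lemma AE_increment_le_nn_integral:
  fixes u :: "int \<Rightarrow> nat \<Rightarrow> 'a \<Rightarrow> real"
  assumes lim: "\<And>n. AE x in M. (\<lambda>N::nat. \<Sum>k\<in>{- int N..int N}. u k n x) \<longlonglongrightarrow> f n x"
  shows "AE x in M. ennreal \<bar>f (Suc i) x - f i x\<bar>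
    \<le> (\<integral>\<^sup>+ k. ennreal \<bar>u k (Suc i) x - u k i x\<bar> \<partial>count_space UNIV)"
  using lim[of i] lim[of "Suc i"]
proof eventually_elim
  case (elim x)
  let ?h = "\<lambda>k. u k (Suc i) x - u k i x"
  have "(\<lambda>N::nat. \<Sum>k\<in>{- int N..int N}. ?h k) \<longlonglongrightarrow> f (Suc i) x - f i x"
    using tendsto_diff[OF elim(2,1)] by (simp add: sum_subtractf)
  then have lim': "(\<lambda>N::nat. ennreal \<bar>\<Sum>k\<in>{- int N..int N}. ?h k\<bar>) \<longlonglongrightarrow> ennreal \<bar>f (Suc i) x - f i x\<bar>"
    by (intro tendsto_ennrealI tendsto_rabs)
  have "ennreal \<bar>\<Sum>k\<in>{- int N..int N}. ?h k\<bar> \<le> (\<integral>\<^sup>+ k. ennreal \<bar>?h k\<bar> \<partial>count_space UNIV)" for N :: nat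
  proof -
    have "ennreal \<bar>\<Sum>k\<in>{- int N..int N}. ?h k\<bar> \<le> ennreal (\<Sum>k\<in>{- int N..int N}. \<bar>?h k\<bar>)"
      by (intro ennreal_leI sum_abs)
    also have "\<dots> = (\<integral>\<^sup>+ k. ennreal \<bar>?h k\<bar> \<partial>count_space {- int N..int N})"
      by (subst nn_integral_count_space_finite) (auto simp: sum_ennreal)
    also have "\<dots> \<le> (\<integral>\<^sup>+ k. ennreal \<bar>?h k\<bar> \<partial>count_space UNIV)"
      by (subst nn_integral_count_space_indicator)
        (auto intro!: nn_integral_mono split: split_indicator)
    finally show ?thesis .
  qed
  then show ?case
    using LIMSEQ_le_const2[OF lim'] by blast
qed

text \<open>Minkowski's inequality \<open>s(f) \<le> \<Sum>\<^sub>k \<mu>\<^sub>k s(a\<^sub>k)\<close> is replaced by one weighted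
  Cauchy--Schwarz inequality with the \<open>F\<^sub>i\<close>-measurable weights \<open>c\<^sub>k 1{\<nu>\<^sub>k \<le> i}\<close>.\<close>
lemma sfun_le_atomic_sum:
  assumes \<phi>: "musielak_orlicz M \<phi>" and f: "martingale0 M F f"
    and dec: "at_decomp M F \<phi> f \<mu> a \<nu>"
  shows "AE x in M. sfun M F f x \<le> (\<integral>\<^sup>+ k. ennreal (\<mu> k) * indicator (Bset M (\<nu> k)) x
        / lux M \<phi> (indicator (Bset M (\<nu> k))) \<partial>count_space UNIV)"
proof -
  define L where "L k = lux M \<phi> (indicator (Bset M (\<nu> k)))" for k
  \<comment> \<open>The value 0 in the degenerate cases keeps the weights real; there the increments
    of the atom turn out to vanish almost everywhere.\<close>
  define c where "c k = (if L k = 0 \<or> L k = \<infinity> then 0 else \<mu> k / enn2real (L k))" for k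
  define A where "A k n = real_cond_exp M (F n) (a k)" for k n
  define h where "h i k x = \<mu> k * (A k (Suc i) x - A k i x)" for i k x
  define D where "D i k = {x \<in> space M. \<nu> k x \<le> enat i}" for i k
  define b where "b i k x = c k * indicator (D i k) x" for i k x
  define q where "q k i x = nn_cond_exp M (F i) (\<lambda>y. ennreal ((A k (Suc i) y - A k i y)\<^sup>2)) x" for k i x
  have \<mu>: "0 \<le> \<mu> k" and at: "is_atom M F \<phi> (a k) (\<nu> k)" for k
    using dec by (auto simp: at_decomp_def)
  have stop: "stopping_time_nat M F (\<nu> k)" for k
    using at by (simp add: is_atom_def)
  have D: "D i k \<in> sets (F i)" for i k
    using stop by (simp add: stopping_time_nat_def D_def)
  have [measurable]: "D i k \<in> sets M" for i k
    by (rule sets_F_M[OF D])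
  have D_sub: "D i k \<subseteq> Bset M (\<nu> k)" for i k
    by (auto simp: D_def Bset_def enat_finite_iff_le simp del: enat_ord_simps)
  have B: "Bset M (\<nu> k) \<in> sets M" for k
    by (rule Bset_in_sets[OF stop])
  have [measurable]: "A k n \<in> borel_measurable M" for k n
    unfolding A_def by measurable
  have [measurable]: "h i k \<in> borel_measurable M" for i k
    unfolding h_def by measurable
  have [measurable]: "b i k \<in> borel_measurable M" for i k
    unfolding b_def by measurable
  have [measurable]: "f n \<in> borel_measurable M" for n
    using f by (auto simp: martingale0_def intro: measurable_F_M)
  have c: "0 \<le> c k" for k
    using \<mu> by (auto simp: c_def)
  have b: "0 \<le> b i k x" for i k x
    using c by (simp add: b_def)
  have q_bound: "AE x in M. x \<in> Bset M (\<nu> k) \<longrightarrow> (\<Sum>i. q k i x) \<le> (inverse (L k))\<^sup>2" for k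
  proof -
    have "AE x in M. x \<in> Bset M (\<nu> k) \<longrightarrow> sfun M F (A k) x \<le> inverse (L k)"
      using at[of k] by (simp add: is_atom_def A_def[abs_def] L_def)
    then show ?thesis
    proof eventually_elim
      case (elim x)
      show ?case
      proof
        assume "x \<in> Bset M (\<nu> k)"
        with elim have "(sfun M F (A k) x)\<^sup>2 \<le> (inverse (L k))\<^sup>2"
          by (intro power_mono) auto
        then show "(\<Sum>i. q k i x) \<le> (inverse (L k))\<^sup>2"
          by (simp add: sfun_power2 q_def)
      qed
    qed
  qed
  \<comment> \<open>Cauchy-Schwarz allows a weight to vanish only where the increment does. Off
    \<open>D i k\<close> one has \<open>\<nu> k x \<ge> Suc i\<close>, so the atom condition at
    levels i and \<open>Suc i\<close> kills both terms of the increment. On \<open>D i k\<close> the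
    weight vanishes only if \<open>c k = 0\<close>, which is split by cause.\<close>
  have h0: "AE x in M. b i k x = 0 \<longrightarrow> h i k x = 0" for i k
  proof -
    have out: "AE x in M. x \<notin> D i k \<longrightarrow> h i k x = 0"
    proof -
      have "AE x in M. enat i \<le> \<nu> k x \<longrightarrow> A k i x = 0" "AE x in M. enat (Suc i) \<le> \<nu> k x \<longrightarrow> A k (Suc i) x = 0"
        using at[of k] by (auto simp: is_atom_def A_def)
      with AE_space show ?thesis
      proof eventually_elim
        case (elim x)
        show ?case
        proof
          assume "x \<notin> D i k"
          then have "enat i < \<nu> k x" using elim(1) by (auto simp: D_def)
          then have "enat i \<le> \<nu> k x" "enat (Suc i) \<le> \<nu> k x"
            by (auto simp: Suc_ile_eq)
          with elim show "h i k x = 0" by (simp add: h_def)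
        qed
      qed
    qed
    consider "\<mu> k = 0" | "L k = 0" | "L k = \<infinity>" | "c k \<noteq> 0"
      unfolding c_def by (metis divide_eq_0_iff enn2real_eq_0_iff infinity_ennreal_def)
    then show ?thesis
    proof cases
      case 1
      then show ?thesis by (simp add: h_def)
    next
      case 2
      then have "AE x in M. x \<notin> Bset M (\<nu> k)"
        unfolding L_def by (rule AE_notin_if_lux_indicator_zero[OF \<phi> B])
      with out show ?thesis
        by eventually_elim (use D_sub in auto)
    next
      \<comment> \<open>Now \<open>inverse (L k) = 0\<close>, so the square function of the atom
        vanishes on \<open>Bset M (\<nu> k)\<close>, and with it each increment on
        \<open>D i k\<close>.\<close>
      case 3
      have "AE x in M. x \<in> D i k \<longrightarrow> q k i x = 0"
        using q_bound[of k]
      proof eventually_elim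
        case (elim x)
        show ?case
        proof
          assume "x \<in> D i k"
          with elim D_sub 3 have "(\<Sum>i. q k i x) = 0" by auto
          then show "q k i x = 0" by (simp add: suminf_eq_zero_iff)
        qed
      qed
      then have "AE x in M. x \<in> D i k \<longrightarrow> ennreal ((A k (Suc i) x - A k i x)\<^sup>2) = 0"
        unfolding q_def by (rule AE_zero_if_nn_cond_exp_zero[OF _ D, rotated]) measurable
      with out show ?thesis
        by eventually_elim (auto simp: h_def)
    next
      case 4
      from out show ?thesis
        by eventually_elim (use 4 in \<open>auto simp: b_def indicator_def\<close>)
    qed
  qed
  define W where "W i x = (\<integral>\<^sup>+ k. ennreal (b i k x) \<partial>count_space UNIV)" for i x
  define T where "T x = (\<integral>\<^sup>+ k. ennreal (c k) * indicator (Bset M (\<nu> k)) x \<partial>count_space UNIV)" for x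
  \<comment> \<open>\<open>W i\<close> is \<open>F i\<close>-measurable and can leave the
    conditional expectation; its bound T is independent of i and can later leave the sum over
    i.\<close>
  have W_T: "W i x \<le> T x" for i x
    unfolding W_def T_def
    using D_sub c by (intro nn_integral_mono) (auto simp: b_def split: split_indicator)
  have W_meas: "W i \<in> borel_measurable (F i)" for i
    unfolding W_def b_def
    using D by (intro borel_measurable_nn_integral_countable) auto
  have V_meas: "(\<lambda>x. \<integral>\<^sup>+ k. ennreal ((h i k x)\<^sup>2 / b i k x) \<partial>count_space UNIV) \<in> borel_measurable M" for i
    by (rule borel_measurable_nn_integral_countable) measurable
  have step: "AE x in M. nn_cond_exp M (F i) (\<lambda>y. ennreal ((f (Suc i) y - f i y)\<^sup>2)) x
      \<le> T x * (\<integral>\<^sup>+ k. nn_cond_exp M (F i) (\<lambda>y. ennreal ((h i k y)\<^sup>2 / b i k y)) x \<partial>count_space UNIV)" for i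
  proof -
    have "AE x in M. ennreal \<bar>f (Suc i) x - f i x\<bar>
        \<le> (\<integral>\<^sup>+ k. ennreal \<bar>\<mu> k * A k (Suc i) x - \<mu> k * A k i x\<bar> \<partial>count_space UNIV)"
      by (rule AE_increment_le_nn_integral[where u="\<lambda>k n x. \<mu> k * A k n x"])
        (use dec in \<open>auto simp: at_decomp_def A_def\<close>)
    moreover have "AE x in M. \<forall>k. b i k x = 0 \<longrightarrow> h i k x = 0"
      using h0 by (simp add: AE_all_countable)
    ultimately have "AE x in M. ennreal ((f (Suc i) x - f i x)\<^sup>2)
        \<le> W i x * (\<integral>\<^sup>+ k. ennreal ((h i k x)\<^sup>2 / b i k x) \<partial>count_space UNIV)"
    proof eventually_elim
      case (elim x)
      have "ennreal ((f (Suc i) x - f i x)\<^sup>2) = (ennreal \<bar>f (Suc i) x - f i x\<bar>)\<^sup>2"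
        by (simp add: ennreal_power)
      also have "\<dots> \<le> (\<integral>\<^sup>+ k. ennreal \<bar>h i k x\<bar> \<partial>count_space UNIV)\<^sup>2"
        using elim(1) by (intro power_mono) (auto simp: h_def right_diff_distrib)
      also have "\<dots> \<le> W i x * (\<integral>\<^sup>+ k. ennreal ((h i k x)\<^sup>2 / b i k x) \<partial>count_space UNIV)"
        unfolding W_def using elim(2) b by (intro weighted_Cauchy_Schwarz_count_space) auto
      finally show ?case .
    qed
    then have "AE x in M. nn_cond_exp M (F i) (\<lambda>y. ennreal ((f (Suc i) y - f i y)\<^sup>2)) x
      \<le> nn_cond_exp M (F i) (\<lambda>x. W i x * (\<integral>\<^sup>+ k. ennreal ((h i k x)\<^sup>2 / b i k x) \<partial>count_space UNIV)) x"
      using measurable_F_M[OF W_meas] V_meas by (intro F.nn_cond_exp_mono) auto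
    moreover have "AE x in M. W i x * nn_cond_exp M (F i) (\<lambda>x. \<integral>\<^sup>+ k. ennreal ((h i k x)\<^sup>2 / b i k x) \<partial>count_space UNIV) x
      = nn_cond_exp M (F i) (\<lambda>x. W i x * (\<integral>\<^sup>+ k. ennreal ((h i k x)\<^sup>2 / b i k x) \<partial>count_space UNIV)) x"
      by (rule F.nn_cond_exp_prod[OF W_meas V_meas])
    moreover have "AE x in M. nn_cond_exp M (F i) (\<lambda>x. \<integral>\<^sup>+ k. ennreal ((h i k x)\<^sup>2 / b i k x) \<partial>count_space UNIV) x
      = (\<integral>\<^sup>+ k. nn_cond_exp M (F i) (\<lambda>y. ennreal ((h i k y)\<^sup>2 / b i k y)) x \<partial>count_space UNIV)"
      by (rule nn_cond_exp_nn_integral_count_space) measurable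
    ultimately show ?thesis
    proof eventually_elim
      case (elim x)
      show ?case
        using elim(1) mult_right_mono[OF W_T[of i x], of
            "\<integral>\<^sup>+ k. nn_cond_exp M (F i) (\<lambda>y. ennreal ((h i k y)\<^sup>2 / b i k y)) x \<partial>count_space UNIV"]
        unfolding elim(2)[symmetric] elim(3) by (auto intro: order_trans)
    qed
  qed
  have q_step: "AE x in M. nn_cond_exp M (F i) (\<lambda>y. ennreal ((h i k y)\<^sup>2 / b i k y)) x
      = ennreal ((\<mu> k)\<^sup>2 / c k) * indicator (D i k) x * q k i x" for i k
  proof -
    \<comment> \<open>Off \<open>D i k\<close>, and also when \<open>c k = 0\<close>, both sides are
      0 because division by 0 yields 0.\<close>
    have eq: "ennreal ((h i k y)\<^sup>2 / b i k y)
        = (ennreal ((\<mu> k)\<^sup>2 / c k) * indicator (D i k) y) * ennreal ((A k (Suc i) y - A k i y)\<^sup>2)" for y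
      using c[of k] by (auto simp: h_def b_def power_mult_distrib simp flip: ennreal_mult split: split_indicator)
    have "AE x in M. ennreal ((\<mu> k)\<^sup>2 / c k) * indicator (D i k) x * q k i x
        = nn_cond_exp M (F i) (\<lambda>y. (ennreal ((\<mu> k)\<^sup>2 / c k) * indicator (D i k) y) * ennreal ((A k (Suc i) y - A k i y)\<^sup>2)) x"
      unfolding q_def by (rule F.nn_cond_exp_prod) (use D in measurable)
    then show ?thesis
      unfolding eq by eventually_elim simp
  qed
  have "AE x in M. \<forall>i. nn_cond_exp M (F i) (\<lambda>y. ennreal ((f (Suc i) y - f i y)\<^sup>2)) x
      \<le> T x * (\<integral>\<^sup>+ k. nn_cond_exp M (F i) (\<lambda>y. ennreal ((h i k y)\<^sup>2 / b i k y)) x \<partial>count_space UNIV)"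
    using step by (simp add: AE_all_countable)
  moreover have "AE x in M. \<forall>i k. nn_cond_exp M (F i) (\<lambda>y. ennreal ((h i k y)\<^sup>2 / b i k y)) x
      = ennreal ((\<mu> k)\<^sup>2 / c k) * indicator (D i k) x * q k i x"
    using q_step by (simp add: AE_all_countable)
  moreover have "AE x in M. \<forall>k. x \<in> Bset M (\<nu> k) \<longrightarrow> (\<Sum>i. q k i x) \<le> (inverse (L k))\<^sup>2"
    using q_bound by (simp add: AE_all_countable)
  ultimately show ?thesis
  proof eventually_elim
    case (elim x)
    have term_le: "(\<Sum>i. ennreal ((\<mu> k)\<^sup>2 / c k) * indicator (D i k) x * q k i x)
        \<le> ennreal (c k) * indicator (Bset M (\<nu> k)) x" for k
    proof (cases "c k = 0 \<or> x \<notin> Bset M (\<nu> k)")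
      case True
      then have "ennreal ((\<mu> k)\<^sup>2 / c k) * indicator (D i k) x = 0" for i
        using D_sub[of i k] by (auto simp: indicator_def)
      then show ?thesis by (simp only: mult_zero_left suminf_zero zero_le)
    next
      case False
      then obtain l where l: "L k = ennreal l" "0 < l" "c k = \<mu> k / l" "0 < \<mu> k"
        using \<mu>[of k] by (cases "L k") (auto simp: c_def split: if_splits)
      have "(\<Sum>i. ennreal ((\<mu> k)\<^sup>2 / c k) * indicator (D i k) x * q k i x)
          \<le> (\<Sum>i. ennreal ((\<mu> k)\<^sup>2 / c k) * q k i x)"
        by (intro suminf_le) (auto split: split_indicator)
      also have "\<dots> \<le> ennreal ((\<mu> k)\<^sup>2 / c k) * (inverse (L k))\<^sup>2"
        using elim(3) False by (auto intro!: mult_left_mono)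
      also have "\<dots> = ennreal ((\<mu> k)\<^sup>2 / c k * (inverse l)\<^sup>2)"
        using l by (subst ennreal_mult) (auto simp: inverse_ennreal ennreal_power)
      \<comment> \<open>This identity is what dictates the choice \<open>c k = \<mu> k / l\<close>:
        the second Cauchy-Schwarz factor reproduces the first.\<close>
      also have "(\<mu> k)\<^sup>2 / c k * (inverse l)\<^sup>2 = c k"
        using l by (simp add: field_simps power2_eq_square)
      finally show ?thesis using False by simp
    qed
    have "(sfun M F f x)\<^sup>2 \<le> (\<Sum>i. T x * (\<integral>\<^sup>+ k. ennreal ((\<mu> k)\<^sup>2 / c k) * indicator (D i k) x * q k i x \<partial>count_space UNIV))"
      unfolding sfun_power2 using elim(1,2) by (intro suminf_le) auto
    also have "\<dots> = T x * (\<integral>\<^sup>+ k. (\<Sum>i. ennreal ((\<mu> k)\<^sup>2 / c k) * indicator (D i k) x * q k i x) \<partial>count_space UNIV)"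
      by (subst nn_integral_suminf) auto
    also have "\<dots> \<le> T x * T x"
      unfolding T_def[of x] by (intro mult_left_mono nn_integral_mono term_le) auto
    finally have "epow ((sfun M F f x)\<^sup>2) (1/2) \<le> epow ((T x)\<^sup>2) (1/2)"
      by (intro epow_mono) (auto simp: power2_eq_square)
    then have "sfun M F f x \<le> T x"
      by (simp only: epow_power2_half)
    also have "\<dots> \<le> (\<integral>\<^sup>+ k. ennreal (\<mu> k) * indicator (Bset M (\<nu> k)) x / L k \<partial>count_space UNIV)"
      unfolding T_def
    proof (intro nn_integral_mono)
      fix k
      show "ennreal (c k) * indicator (Bset M (\<nu> k)) x \<le> ennreal (\<mu> k) * indicator (Bset M (\<nu> k)) x / L k"
        using \<mu>[of k] by (cases "L k") (auto simp: c_def divide_ennreal split: split_indicator)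
    qed
    finally show ?case unfolding L_def .
  qed
qed

lemma Hs_norm_le_at_value:
  assumes \<phi>: "musielak_orlicz M \<phi>" and f: "martingale0 M F f" and r: "0 < r" "r \<le> 1"
    and dec: "at_decomp M F \<phi> f \<mu> a \<nu>"
  shows "Hs_norm M F \<phi> f \<le> at_value M \<phi> r \<mu> \<nu>"
  unfolding Hs_norm_def at_value_def
proof (rule lux_mono_AE[OF \<phi>])
  show "AE x in M. sfun M F f x \<le> epow (\<integral>\<^sup>+ k. epow (ennreal (\<mu> k) * indicator (Bset M (\<nu> k)) x
        / lux M \<phi> (indicator (Bset M (\<nu> k)))) r \<partial>count_space UNIV) (1 / r)"
    using sfun_le_atomic_sum[OF \<phi> f dec]
    by eventually_elim (rule order_trans[OF _ nn_integral_count_space_le_epow[OF r]])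
qed

end

section \<open>Closing square-summable martingale differences\<close>

lemma integrable_mult_if_square_integrable:
  fixes X Y :: "'a \<Rightarrow> real"
  assumes [measurable]: "X \<in> borel_measurable M" "Y \<in> borel_measurable M"
    and "integrable M (\<lambda>x. (X x)\<^sup>2)" "integrable M (\<lambda>x. (Y x)\<^sup>2)"
  shows "integrable M (\<lambda>x. X x * Y x)"
proof (rule Bochner_Integration.integrable_bound)
  show "integrable M (\<lambda>x. (X x)\<^sup>2 + (Y x)\<^sup>2)"
    using assms by simp
  show "AE x in M. norm (X x * Y x) \<le> norm ((X x)\<^sup>2 + (Y x)\<^sup>2)"
  proof (intro AE_I2)
    fix x
    have "2 * (\<bar>X x\<bar> * \<bar>Y x\<bar>) \<le> (X x)\<^sup>2 + (Y x)\<^sup>2"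
      using sum_squares_bound[of "\<bar>X x\<bar>" "\<bar>Y x\<bar>"] by simp
    moreover have "0 \<le> \<bar>X x\<bar> * \<bar>Y x\<bar>" "norm ((X x)\<^sup>2 + (Y x)\<^sup>2) = (X x)\<^sup>2 + (Y x)\<^sup>2"
      by simp_all
    ultimately show "norm (X x * Y x) \<le> norm ((X x)\<^sup>2 + (Y x)\<^sup>2)"
      unfolding real_norm_def abs_mult by linarith
  qed
qed measurable

context filtered_prob_space
begin

text \<open>The increments are orthogonal, so the partial sums are Cauchy in L2 and hence in L1. A
  fast subsequence converges almost everywhere with summable L1 increments, and its limit keeps the
  integrals over sets of \<open>F n\<close>. This supplies the single integrable function that an
  atom has to be.\<close>

lemma L2_martingale_closed:
  fixes D :: "nat \<Rightarrow> 'a \<Rightarrow> real"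
  assumes meas: "\<And>i. D i \<in> borel_measurable (F (Suc i))"
    and int: "\<And>i. integrable M (D i)"
    and cond: "\<And>i. AE x in M. real_cond_exp M (F i) (D i) x = 0"
    and fin: "(\<Sum>i. \<integral>\<^sup>+ x. ennreal ((D i x)\<^sup>2) \<partial>M) < \<infinity>"
  obtains a where "integrable M a"
    and "\<And>n. AE x in M. real_cond_exp M (F n) a x = (\<Sum>i<n. D i x)"
proof -
  note int [measurable]
  have ind_int: "integrable M (\<lambda>x. indicator A x * X x)"
    if "A \<in> sets M" "integrable M X" for A and X :: "'a \<Rightarrow> real"
    using integrable_mult_indicator[OF that] by simp
  define G where "G n x = (\<Sum>i<n. D i x)" for n x
  define v where "v i = (\<integral>x. (D i x)\<^sup>2 \<partial>M)" for i
  have sq: "integrable M (\<lambda>x. (D i x)\<^sup>2)" for i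
  proof -
    have "(\<integral>\<^sup>+ x. ennreal ((D i x)\<^sup>2) \<partial>M) \<le> (\<Sum>i. \<integral>\<^sup>+ x. ennreal ((D i x)\<^sup>2) \<partial>M)"
      using sum_le_suminf[of "\<lambda>i. \<integral>\<^sup>+ x. ennreal ((D i x)\<^sup>2) \<partial>M" "{i}"] by auto
    with fin show ?thesis
      by (intro integrableI_bounded) auto
  qed
  have v: "ennreal (v i) = (\<integral>\<^sup>+ x. ennreal ((D i x)\<^sup>2) \<partial>M)" "0 \<le> v i" for i
    using sq by (auto simp: v_def nn_integral_eq_integral)
  have "summable v"
    using fin v by (intro summable_suminf_not_top) auto
  have G_int: "integrable M (G n)" for n
    unfolding G_def[abs_def] using int by auto
  have G_meas: "G n \<in> borel_measurable (F n)" for n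
    unfolding G_def[abs_def] by (intro borel_measurable_sum measurable_F_mono[OF meas]) auto
  note G_int [measurable]
  have ortho: "integrable M (\<lambda>x. (G n x - G m x)\<^sup>2) \<and> (\<integral>x. (G n x - G m x)\<^sup>2 \<partial>M) = sum v {m..<n}"
    if "m \<le> n" for m n
    using that
  proof (induction n rule: dec_induct)
    case base
    show ?case by simp
  next
    case (step n)
    let ?X = "\<lambda>x. G n x - G m x"
    have eq: "(G (Suc n) x - G m x)\<^sup>2 = (?X x)\<^sup>2 + 2 * (?X x * D n x) + (D n x)\<^sup>2" for x
      by (simp add: G_def power2_eq_square algebra_simps)
    have XD: "integrable M (\<lambda>x. ?X x * D n x)"
      using step.IH sq by (intro integrable_mult_if_square_integrable) auto
    have "?X \<in> borel_measurable (F n)"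
      using G_meas measurable_F_mono[OF G_meas \<open>m \<le> n\<close>] by auto
    \<comment> \<open>The cross term vanishes because \<open>G n - G m\<close> is
      \<open>F n\<close>-measurable and \<open>D n\<close> has conditional mean 0.\<close>
    then have "(\<integral>x. ?X x * D n x \<partial>M) = (\<integral>x. ?X x * real_cond_exp M (F n) (D n) x \<partial>M)"
      using XD by (intro F.real_cond_exp_intg(2)[symmetric]) auto
    also have "\<dots> = (\<integral>x. 0 \<partial>M)"
      using cond[of n] by (intro integral_cong_AE) auto
    finally show ?case
      unfolding eq using step XD sq by (simp add: v_def)
  qed
  have L1: "(\<integral>x. \<bar>G n x - G m x\<bar> \<partial>M) \<le> sqrt (sum v {m..<n})" if "m \<le> n" for m n
  proof -
    \<comment> \<open>Nonnegativity of the variance of \<open>\<bar>G n - G m\<bar>\<close> bounds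
      the L1 norm by the L2 norm.\<close>
    have "0 \<le> (\<integral>x. (\<bar>G n x - G m x\<bar> - (\<integral>x. \<bar>G n x - G m x\<bar> \<partial>M))\<^sup>2 \<partial>M)"
      by simp
    also have "\<dots> = sum v {m..<n} - (\<integral>x. \<bar>G n x - G m x\<bar> \<partial>M)\<^sup>2"
      using ortho[OF that] G_int by (subst variance_eq) auto
    finally show ?thesis
      by (intro real_le_rsqrt) simp
  qed
  \<comment> \<open>Variance tails below 4^-j give L1 increments of at most 2^-j, which are
    summable.\<close>
  have "\<exists>N. \<forall>m\<ge>N. \<forall>n. norm (sum v {m..<n}) < (1/4) ^ j" for j
    using \<open>summable v\<close> unfolding summable_Cauchy by (rule allE[of _ "(1/4) ^ j"]) auto
  then obtain N where N: "\<And>j m n. N j \<le> m \<Longrightarrow> norm (sum v {m..<n}) < (1/4) ^ j"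
    by metis
  \<comment> \<open>Summing all \<open>N l\<close> up to j makes p monotone and at least
    \<open>N j\<close>; the extra j makes p unbounded.\<close>
  define p where "p j = j + (\<Sum>l\<le>j. N l)" for j
  have p: "N j \<le> p j" "j \<le> p j" "p j \<le> p (Suc j)" for j
    by (auto simp: p_def intro: trans_le_add2 member_le_sum)
  define u where "u j x = G (p (Suc j)) x - G (p j) x" for j x
  have u_int: "integrable M (u j)" for j
    unfolding u_def[abs_def] using G_int by auto
  note u_int [measurable]
  have u_le: "(\<integral>x. \<bar>u j x\<bar> \<partial>M) \<le> (1/2) ^ j" for j
  proof -
    have "(\<integral>x. \<bar>u j x\<bar> \<partial>M) \<le> sqrt (sum v {p j..<p (Suc j)})"
      unfolding u_def by (rule L1[OF p(3)])
    also have "\<dots> \<le> sqrt ((1/4) ^ j)"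
      using N[OF p(1), of j "p (Suc j)"] by (intro real_sqrt_le_mono) auto
    also have "\<dots> = (1/2) ^ j"
      by (simp add: real_sqrt_power real_sqrt_divide)
    finally show ?thesis .
  qed
  have u_sum: "summable (\<lambda>j. \<integral>x. \<bar>u j x\<bar> \<partial>M)"
    by (rule summable_comparison_test'[of "\<lambda>j. (1/2) ^ j"]) (use u_le in auto)
  have u_AE: "AE x in M. summable (\<lambda>j. \<bar>u j x\<bar>)"
  proof -
    have "(\<integral>\<^sup>+x. (\<Sum>j. ennreal \<bar>u j x\<bar>) \<partial>M) = (\<Sum>j. \<integral>\<^sup>+x. ennreal \<bar>u j x\<bar> \<partial>M)"
      by (rule nn_integral_suminf) measurable
    also have "\<dots> = (\<Sum>j. ennreal (\<integral>x. \<bar>u j x\<bar> \<partial>M))"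
      by (intro arg_cong[where f=suminf] ext nn_integral_eq_integral integrable_abs u_int AE_I2) simp
    also have "\<dots> \<noteq> \<infinity>"
      unfolding infinity_ennreal_def by (rule ennreal_suminf_neq_top[OF u_sum]) simp
    finally have "AE x in M. (\<Sum>j. ennreal \<bar>u j x\<bar>) \<noteq> \<infinity>"
      by (intro nn_integral_noteq_infinite) auto
    then show ?thesis
      by eventually_elim (auto intro: summable_suminf_not_top)
  qed
  define a where "a x = G (p 0) x + (\<Sum>j. u j x)" for x
  have a_int: "integrable M a"
    unfolding a_def[abs_def] using G_int u_int u_AE u_sum
    by (intro Bochner_Integration.integrable_add integrable_suminf) auto
  have mart: "(\<integral>x. indicator A x * G m x \<partial>M) = (\<integral>x. indicator A x * G n x \<partial>M)"
    if A: "A \<in> sets (F n)" and "n \<le> m" for A n m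
    using \<open>n \<le> m\<close>
  proof (induction m rule: dec_induct)
    case (step m)
    note [measurable] = sets_F_M[OF A]
    have A': "A \<in> sets (F m)"
      using A subalgebra_F_mono[OF \<open>n \<le> m\<close>] by (auto simp: subalgebra_def)
    have iD: "integrable M (\<lambda>x. indicator A x * D m x)" and iG: "integrable M (\<lambda>x. indicator A x * G m x)"
      using ind_int[OF sets_F_M[OF A]] int G_int by auto
    have "(\<integral>x. indicator A x * D m x \<partial>M) = (\<integral>x. indicator A x * real_cond_exp M (F m) (D m) x \<partial>M)"
      using A' iD by (intro F.real_cond_exp_intg(2)[symmetric]) auto
    also have "\<dots> = (\<integral>x. 0 \<partial>M)"
      using cond[of m] by (intro integral_cong_AE) auto
    finally have "(\<integral>x. indicator A x * D m x \<partial>M) = 0" by simp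
    moreover have "(\<integral>x. indicator A x * G (Suc m) x \<partial>M)
        = (\<integral>x. indicator A x * G m x + indicator A x * D m x \<partial>M)"
      by (simp add: G_def algebra_simps)
    ultimately show ?case
      using step.IH iD iG by simp
  qed simp
  have "AE x in M. real_cond_exp M (F n) a x = G n x" for n
  proof (rule F.real_cond_exp_charact[OF _ a_int G_int G_meas])
    fix A assume A: "A \<in> sets (F n)"
    note [measurable] = sets_F_M[OF A]
    have iu: "integrable M (\<lambda>x. indicator A x * u j x)" and iG: "integrable M (\<lambda>x. indicator A x * G j x)" for j
      using ind_int[OF sets_F_M[OF A]] u_int G_int by auto
    have le: "\<bar>indicator A x * u j x\<bar> \<le> \<bar>u j x\<bar>" for x j
      by (auto split: split_indicator)
    have AE': "AE x in M. summable (\<lambda>j. norm (indicator A x * u j x))"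
      using u_AE
    proof eventually_elim
      case (elim x)
      show ?case
        by (rule summable_comparison_test'[OF elim, of 0]) (simp only: real_norm_def abs_idempotent le)
    qed
    have sum': "summable (\<lambda>j. \<integral>x. norm (indicator A x * u j x) \<partial>M)"
    proof (rule summable_comparison_test'[OF u_sum, of 0])
      fix j
      have "(\<integral>x. norm (indicator A x * u j x) \<partial>M) \<le> (\<integral>x. \<bar>u j x\<bar> \<partial>M)"
        using iu[of j] u_int[of j] le by (intro integral_mono) auto
      then show "norm (\<integral>x. norm (indicator A x * u j x) \<partial>M) \<le> (\<integral>x. \<bar>u j x\<bar> \<partial>M)"
        by simp
    qed
    have lim: "(\<lambda>J. \<Sum>j<J. \<integral>x. indicator A x * u j x \<partial>M) \<longlonglongrightarrow> (\<integral>x. (\<Sum>j. indicator A x * u j x) \<partial>M)"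
      using sums_integral[OF iu AE' sum'] by (simp add: sums_def)
    have partial: "(\<Sum>j<J. \<integral>x. indicator A x * u j x \<partial>M)
        = (\<integral>x. indicator A x * G (p J) x \<partial>M) - (\<integral>x. indicator A x * G (p 0) x \<partial>M)" for J
    proof -
      have "(\<integral>x. indicator A x * u j x \<partial>M)
          = (\<integral>x. indicator A x * G (p (Suc j)) x \<partial>M) - (\<integral>x. indicator A x * G (p j) x \<partial>M)" for j
        using iG by (simp add: u_def right_diff_distrib)
      then show ?thesis
        using sum_lessThan_telescope[of "\<lambda>j. \<integral>x. indicator A x * G (p j) x \<partial>M" J] by simp
    qed
    \<comment> \<open>Once \<open>p J \<ge> n\<close>, the integral over A is already that of
      \<open>G n\<close>, so the sequence of partial integrals is eventually constant.\<close>
    have "\<forall>\<^sub>F J in sequentially. (\<integral>x. indicator A x * G (p J) x \<partial>M) - (\<integral>x. indicator A x * G (p 0) x \<partial>M)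
        = (\<integral>x. indicator A x * G n x \<partial>M) - (\<integral>x. indicator A x * G (p 0) x \<partial>M)"
      using eventually_ge_at_top[of n]
    proof eventually_elim
      case (elim J)
      then have "n \<le> p J"
        using p(2)[of J] by linarith
      show ?case by (simp only: mart[OF A \<open>n \<le> p J\<close>])
    qed
    then have "(\<integral>x. (\<Sum>j. indicator A x * u j x) \<partial>M)
        = (\<integral>x. indicator A x * G n x \<partial>M) - (\<integral>x. indicator A x * G (p 0) x \<partial>M)"
      using LIMSEQ_unique[OF lim tendsto_eventually] unfolding partial by blast
    moreover have "(\<integral>x. indicator A x * a x \<partial>M)
        = (\<integral>x. indicator A x * G (p 0) x + (\<Sum>j. indicator A x * u j x) \<partial>M)"
    proof (rule Bochner_Integration.integral_cong[OF refl])
      fix x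
      show "indicator A x * a x = indicator A x * G (p 0) x + (\<Sum>j. indicator A x * u j x)"
        by (auto simp: a_def split: split_indicator)
    qed
    ultimately show "(\<integral>x\<in>A. a x \<partial>M) = (\<integral>x\<in>A. G n x \<partial>M)"
      using iG integrable_suminf[OF iu AE' sum'] by (simp add: set_lebesgue_integral_def)
  qed
  with a_int show thesis
    by (intro that[of a]) (auto simp: G_def)
qed

end

section \<open>Dyadic stopping times and the atomic decomposition\<close>

lemma four_powr_eq: "4 powr y = (2 powr y)\<^sup>2" for y :: real
  by (simp add: power2_eq_square flip: powr_mult)

text \<open>The half-open intervals from 4^k to 4^(k+1) partition the positive reals. Closing them
  on the right is what calls for the ceiling in the witness.\<close>

lemma dyadic_shell:
  fixes s :: real
  assumes "0 < s"
  obtains m :: int where "\<And>k::int. (4 powr real_of_int k < s \<and> s \<le> 4 powr (real_of_int k + 1)) \<longleftrightarrow> k = m"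
proof (rule that[of "\<lceil>log 4 s\<rceil> - 1"])
  fix k :: int
  have "4 powr real_of_int k < s \<longleftrightarrow> real_of_int k < log 4 s" "s \<le> 4 powr (real_of_int k + 1) \<longleftrightarrow> log 4 s \<le> real_of_int k + 1"
    using assms by (auto simp: less_log_iff log_le_iff)
  then show "(4 powr real_of_int k < s \<and> s \<le> 4 powr (real_of_int k + 1)) \<longleftrightarrow> k = \<lceil>log 4 s\<rceil> - 1"
    by linarith
qed

text \<open>Only indices k up to m, the floor of log_2 s, contribute. Counting downwards from m
  gives a geometric series of ratio 2^-r, and 2^(m+1) <= 2s accounts for the factor 2^r.\<close>

lemma nn_integral_dyadic_le:
  fixes s r :: real
  assumes r: "0 < r" and s: "0 \<le> s"
  shows "(\<integral>\<^sup>+ k. ennreal ((2 powr (real_of_int k + 1)) powr r) * indicator {k. 2 powr real_of_int k < s} k \<partial>count_space UNIV)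
    \<le> ennreal (2 powr r / (1 - 2 powr (- r)) * s powr r)"
proof (cases "s = 0")
  case True
  then have "{k::int. 2 powr k < s} = {}" by (auto simp: not_less)
  then show ?thesis by simp
next
  case False
  with s have s: "0 < s" by simp
  define m where "m = \<lfloor>log 2 s\<rfloor>"
  define q where "q = 2 powr (- r)"
  have q: "0 < q" "q < 1"
    using r by (auto simp: q_def powr_less_one)
  have bij: "bij_betw (\<lambda>j::nat. m - int j) UNIV {..m}"
    by (rule bij_betwI[where g="\<lambda>k. nat (m - k)"]) auto
  have "k \<le> m" if "2 powr k < s" for k :: int
    using that s by (simp add: m_def le_floor_iff less_log_iff less_imp_le flip: less_log_iff)
  then have "(\<integral>\<^sup>+ k. ennreal ((2 powr (real_of_int k + 1)) powr r) * indicator {k. 2 powr real_of_int k < s} k \<partial>count_space UNIV)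
      \<le> (\<integral>\<^sup>+ k. ennreal ((2 powr (real_of_int k + 1)) powr r) \<partial>count_space {..m})"
    by (subst nn_integral_count_space_indicator) (auto intro!: nn_integral_mono split: split_indicator)
  also have "\<dots> = (\<integral>\<^sup>+ j. ennreal ((2 powr (real_of_int (m - int j) + 1)) powr r) \<partial>count_space UNIV)"
    by (rule nn_integral_bij_count_space[OF bij, symmetric])
  also have "\<dots> = (\<Sum>j. ennreal ((2 powr (real_of_int m + 1)) powr r * q ^ j))"
  proof (subst nn_integral_count_space_nat, intro arg_cong[where f=suminf] ext arg_cong[where f=ennreal])
    fix j :: nat
    have "q ^ j = 2 powr (- r * real j)"
      unfolding q_def by (simp add: powr_powr flip: powr_realpow)
    then show "(2 powr (real_of_int (m - int j) + 1)) powr r = (2 powr (real_of_int m + 1)) powr r * q ^ j"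
      by (simp add: powr_powr flip: powr_add) (simp add: algebra_simps)
  qed
  also have "\<dots> = ennreal ((2 powr (real_of_int m + 1)) powr r * (1 / (1 - q)))"
    using q by (intro suminf_ennreal_eq sums_mult geometric_sums) auto
  also have "\<dots> \<le> ennreal ((2 * s) powr r * (1 / (1 - q)))"
  proof (intro ennreal_leI mult_right_mono powr_mono2)
    have "2 powr real_of_int m \<le> 2 powr (log 2 s)"
      unfolding m_def by (intro powr_mono) auto
    then show "2 powr (real_of_int m + 1) \<le> 2 * s"
      using s by (simp add: powr_add)
  qed (use r q in auto)
  also have "\<dots> = ennreal (2 powr r / (1 - 2 powr (- r)) * s powr r)"
    using s by (simp add: q_def powr_mult)
  finally show ?thesis .
qed

context filtered_prob_space
begin

text \<open>The stopping times are \<open>\<nu>\<^sub>k = inf {n. s\<^sub>n\<^sub>+\<^sub>1(f) > 2\<^sup>k}\<close>; the difference of the martingale stopped at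
  \<open>\<nu>\<^sub>k\<^sub>+\<^sub>1\<close> and at \<open>\<nu>\<^sub>k\<close> has the increments of \<open>f\<close> restricted to the shells \<open>A k i\<close> below.\<close>
lemma atomic_decomposition_exists:
  assumes \<phi>: "musielak_orlicz M \<phi>" and f: "martingale0 M F f" and r: "0 < r"
    and fin: "Hs_norm M F \<phi> f < \<infinity>"
  obtains \<mu> a \<nu> where "at_decomp M F \<phi> f \<mu> a \<nu>"
    and "at_value M \<phi> r \<mu> \<nu> \<le> ennreal ((2 powr r / (1 - 2 powr (- r))) powr (1 / r)) * Hs_norm M F \<phi> f"
proof -
  define d where "d i x = f (Suc i) x - f i x" for i x
  define e where "e i = nn_cond_exp M (F i) (\<lambda>y. ennreal ((d i y)\<^sup>2))" for i
  \<comment> \<open>\<open>S n\<close> is the square of s_(n+1)(f). It is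
    \<open>F n\<close>-measurable although it involves the increment from n to n+1; this
    predictability makes \<open>\<nu> k\<close> a stopping time.\<close>
  define S where "S n x = (\<Sum>i\<le>n. e i x)" for n x
  \<comment> \<open>Powers of 4, since \<open>S n\<close> is compared without taking its square
    root.\<close>
  define t where "t k = ennreal (4 powr real_of_int k)" for k :: int
  define \<nu> where "\<nu> k x = (if \<exists>n. t k < S n x then enat (LEAST n. t k < S n x) else \<infinity>)" for k x
  define B where "B k = Bset M (\<nu> k)" for k
  \<comment> \<open>This shell is the event that
    \<open>\<nu> k \<le> i < \<nu> (k + 1)\<close>.\<close>
  define A where "A k i = {x \<in> space M. t k < S i x \<and> S i x \<le> t (k + 1)}" for k i
  define D where "D k i x = indicator (A k i) x * d i x" for k i x
  define L where "L k = lux M \<phi> (indicator (B k))" for k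
  \<comment> \<open>The shell martingale has square function at most 2^(k+1), so dividing by this
    coefficient gives exactly the size bound of an atom.\<close>
  define \<mu> where "\<mu> k = 2 powr (real_of_int k + 1) * enn2real (L k)" for k

  have f_meas: "f n \<in> borel_measurable (F n)" and f_int: "integrable M (f n)" for n
    using f by (auto simp: martingale0_def)
  note f_int [measurable]
  have d_meas: "d i \<in> borel_measurable (F (Suc i))" for i
    unfolding d_def using f_meas[of "Suc i"] measurable_F_mono[OF f_meas, of i "Suc i"] by auto
  have d_int: "integrable M (d i)" for i
    unfolding d_def using f_int by auto
  note d_int [measurable]
  have d_cond: "AE x in M. real_cond_exp M (F i) (d i) x = 0" for i
  proof -
    have "AE x in M. real_cond_exp M (F i) (d i) x
        = real_cond_exp M (F i) (f (Suc i)) x - real_cond_exp M (F i) (f i) x"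
      unfolding d_def by (rule F.real_cond_exp_diff[OF f_int f_int])
    moreover have "AE x in M. real_cond_exp M (F i) (f (Suc i)) x = f i x"
      using f by (auto simp: martingale0_def)
    moreover have "AE x in M. real_cond_exp M (F i) (f i) x = f i x"
      by (rule F.real_cond_exp_F_meas[OF f_int f_meas])
    ultimately show ?thesis by eventually_elim simp
  qed
  have e_meas: "e i \<in> borel_measurable (F i)" for i
    unfolding e_def by measurable
  have [measurable]: "e i \<in> borel_measurable M" for i
    by (rule measurable_F_M[OF e_meas])
  have S_meas: "S n \<in> borel_measurable (F n)" for n
    unfolding S_def[abs_def] by (intro borel_measurable_sum measurable_F_mono[OF e_meas]) auto
  have S_mono: "S m x \<le> S n x" if "m \<le> n" for m n x
    unfolding S_def using that by (intro sum_mono2) auto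
  have sfun_eq: "sfun M F f x = epow (\<Sum>i. e i x) (1/2)" for x
    by (simp add: sfun_def e_def d_def)
  have S_le: "S n x \<le> (\<Sum>i. e i x)" for n x
    unfolding S_def by (intro sum_le_suminf) auto
  have S_lim: "(\<lambda>n. S n x) \<longlonglongrightarrow> (\<Sum>i. e i x)" for x
    unfolding S_def by (rule summable_LIMSEQ') auto
  have lim_iff: "(\<exists>n. t k < S n x) \<longleftrightarrow> t k < (\<Sum>i. e i x)" for k x
  proof
    assume "t k < (\<Sum>i. e i x)"
    then have "\<forall>\<^sub>F n in sequentially. t k < S n x"
      by (rule order_tendstoD(1)[OF S_lim])
    then show "\<exists>n. t k < S n x" by (auto simp: eventually_sequentially)
  qed (use S_le in \<open>auto intro: less_le_trans\<close>)
  have \<nu>_le: "\<nu> k x \<le> enat n \<longleftrightarrow> t k < S n x" for k x n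
  proof
    assume "\<nu> k x \<le> enat n"
    then have ex: "\<exists>n. t k < S n x" and le: "(LEAST n. t k < S n x) \<le> n"
      by (auto simp: \<nu>_def split: if_splits)
    from LeastI_ex[OF ex] S_mono[OF le] show "t k < S n x"
      by (rule less_le_trans)
  next
    assume "t k < S n x"
    then show "\<nu> k x \<le> enat n"
      by (auto simp: \<nu>_def intro: Least_le)
  qed
  have t_sfun: "t k < (\<Sum>i. e i x) \<longleftrightarrow> ennreal (2 powr real_of_int k) < sfun M F f x" for k x
  proof -
    have t_sq: "t k = (ennreal (2 powr real_of_int k))\<^sup>2"
      by (simp add: t_def ennreal_power four_powr_eq)
    then have t2: "epow (t k) (1/2) = ennreal (2 powr real_of_int k)"
      by (simp only: epow_power2_half)
    have sfun_sq: "(\<Sum>i. e i x) = (sfun M F f x)\<^sup>2"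
      by (simp add: sfun_eq epow_half_power2)
    have "(\<Sum>i. e i x) \<le> t k \<longleftrightarrow> sfun M F f x \<le> ennreal (2 powr real_of_int k)"
    proof
      assume "(\<Sum>i. e i x) \<le> t k"
      then show "sfun M F f x \<le> ennreal (2 powr real_of_int k)"
        unfolding sfun_eq t2[symmetric] by (rule epow_mono) simp
    next
      assume "sfun M F f x \<le> ennreal (2 powr real_of_int k)"
      then show "(\<Sum>i. e i x) \<le> t k"
        unfolding sfun_sq t_sq by (intro power_mono) auto
    qed
    then show ?thesis by (simp flip: not_le)
  qed
  have B_eq: "B k = {x \<in> space M. ennreal (2 powr real_of_int k) < sfun M F f x}" for k
    by (auto simp: B_def Bset_def enat_finite_iff_le \<nu>_le lim_iff t_sfun simp del: enat_ord_simps)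
  have B_sets [measurable]: "B k \<in> sets M" for k
    unfolding B_eq by measurable
  have A_sets: "A k i \<in> sets (F i)" for k i
    using S_meas[of i] unfolding A_def space_F[of i, symmetric] by measurable
  have [measurable]: "A k i \<in> sets M" for k i
    by (rule sets_F_M[OF A_sets])
  have A_B: "A k i \<subseteq> B k" for k i
    unfolding A_def B_def Bset_def enat_finite_iff_le \<nu>_le by auto
  have stop: "stopping_time_nat M F (\<nu> k)" for k
    unfolding stopping_time_nat_def \<nu>_le
  proof
    fix n
    show "{x \<in> space M. t k < S n x} \<in> sets (F n)"
      using S_meas[of n] unfolding space_F[of n, symmetric] by measurable
  qed

  \<comment> \<open>At the last index n lying in shell k, the partial sum is at most
    \<open>S n x\<close>, hence at most \<open>t (k + 1)\<close>; indices outside the shell add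
    nothing.\<close>
  have A_sum: "(\<Sum>i. indicator (A k i) x * e i x) \<le> t (k + 1)" for k x
  proof (rule suminf_le_const)
    fix n
    show "(\<Sum>i<n. indicator (A k i) x * e i x) \<le> t (k + 1)"
    proof (induction n)
      case (Suc n)
      show ?case
      proof (cases "x \<in> A k n")
        case True
        have "(\<Sum>i<Suc n. indicator (A k i) x * e i x) \<le> S n x"
          unfolding S_def lessThan_Suc_atMost by (intro sum_mono) (auto split: split_indicator)
        with True show ?thesis by (auto simp: A_def)
      qed (use Suc in simp)
    qed simp
  qed auto
  have D_meas: "D k i \<in> borel_measurable (F (Suc i))" for k i
  proof -
    have "A k i \<in> sets (F (Suc i))"
      using A_sets[of k i] subalgebra_F_mono[of i "Suc i"] by (auto simp: subalgebra_def)
    then show ?thesis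
      unfolding D_def using d_meas[of i] by measurable
  qed
  have D_int: "integrable M (D k i)" for k i
    using integrable_mult_indicator[of "A k i" M "d i"] d_int by (simp add: D_def[abs_def])
  have D_cond: "AE x in M. real_cond_exp M (F i) (D k i) x = 0" for k i
  proof -
    have "AE x in M. real_cond_exp M (F i) (D k i) x = indicator (A k i) x * real_cond_exp M (F i) (d i) x"
      unfolding D_def[abs_def]
      by (rule F.real_cond_exp_mult) (use A_sets D_int in \<open>auto simp: D_def[abs_def]\<close>)
    with d_cond[of i] show ?thesis by eventually_elim simp
  qed
  have D_sq: "ennreal ((D k i x)\<^sup>2) = indicator (A k i) x * ennreal ((d i x)\<^sup>2)" for k i x
    by (simp add: D_def split: split_indicator)
  have D_fin: "(\<Sum>i. \<integral>\<^sup>+ x. ennreal ((D k i x)\<^sup>2) \<partial>M) < \<infinity>" for k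
  proof -
    have "(\<Sum>i. \<integral>\<^sup>+ x. ennreal ((D k i x)\<^sup>2) \<partial>M) = (\<Sum>i. \<integral>\<^sup>+ x. indicator (A k i) x * e i x \<partial>M)"
      unfolding D_sq e_def
      by (intro arg_cong[where f=suminf] ext F.nn_cond_exp_intg[symmetric]) (use A_sets in auto)
    also have "\<dots> = (\<integral>\<^sup>+ x. (\<Sum>i. indicator (A k i) x * e i x) \<partial>M)"
      by (rule nn_integral_suminf[symmetric]) measurable
    also have "\<dots> \<le> (\<integral>\<^sup>+ x. t (k + 1) \<partial>M)"
      by (intro nn_integral_mono A_sum)
    also have "\<dots> < \<infinity>"
      by (simp add: emeasure_space_1 t_def)
    finally show ?thesis .
  qed
  have "\<exists>g. integrable M g \<and> (\<forall>n. AE x in M. real_cond_exp M (F n) g x = (\<Sum>i<n. D k i x))" for k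
    by (rule L2_martingale_closed[OF D_meas D_int D_cond D_fin[of k]]) blast
  then obtain g where g_int: "integrable M (g k)"
    and g_cond: "AE x in M. real_cond_exp M (F n) (g k) x = (\<Sum>i<n. D k i x)" for k n
    by metis
  note g_int [measurable]
  define a where "a k x = g k x / \<mu> k" for k x
  have a_int: "integrable M (a k)" for k
    unfolding a_def[abs_def] using g_int by auto
  have a_cond: "AE x in M. real_cond_exp M (F n) (a k) x = (\<Sum>i<n. D k i x) / \<mu> k" for k n
    using F.real_cond_exp_cdiv[OF g_int, of n k "\<mu> k"] g_cond[of n k]
    unfolding a_def[abs_def] by eventually_elim simp

  \<comment> \<open>Chebyshev's argument: on \<open>B k\<close> the function s(f) exceeds
    2^k.\<close>
  have L_fin: "L k < \<infinity>" for k
  proof -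
    have c: "0 < 1 / 2 powr real_of_int k" by simp
    have "L k \<le> lux M \<phi> (\<lambda>x. ennreal (1 / 2 powr real_of_int k) * sfun M F f x)"
      unfolding L_def
    proof (intro lux_mono_AE[OF \<phi>] AE_I2)
      fix x
      show "indicator (B k) x \<le> ennreal (1 / 2 powr real_of_int k) * sfun M F f x"
      proof (cases "x \<in> B k")
        case True
        have "1 = ennreal (1 / 2 powr real_of_int k) * ennreal (2 powr real_of_int k)"
          by (simp flip: ennreal_mult)
        also have "\<dots> \<le> ennreal (1 / 2 powr real_of_int k) * sfun M F f x"
          using True by (intro mult_left_mono) (auto simp: B_eq)
        finally show ?thesis using True by simp
      qed simp
    qed
    also have "\<dots> \<le> ennreal (1 / 2 powr real_of_int k) * Hs_norm M F \<phi> f"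
      unfolding Hs_norm_def by (rule lux_cmult_le[OF c])
    also have "\<dots> < \<infinity>"
      using fin by (simp add: ennreal_mult_less_top)
    finally show ?thesis .
  qed
  have \<mu>_nonneg: "0 \<le> \<mu> k" for k
    by (simp add: \<mu>_def)
  have \<mu>_zero: "\<mu> k = 0 \<longleftrightarrow> L k = 0" for k
    using L_fin[of k] by (auto simp: \<mu>_def enn2real_eq_0_iff)

  have atom: "is_atom M F \<phi> (a k) (\<nu> k)" for k
    unfolding is_atom_def
  proof (intro conjI allI)
    show "a k \<in> borel_measurable M" "integrable M (a k)" "stopping_time_nat M F (\<nu> k)"
      using a_int stop by auto
  next
    fix n
    show "AE x in M. enat n \<le> \<nu> k x \<longrightarrow> real_cond_exp M (F n) (a k) x = 0"
      using a_cond[of n k]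
    proof eventually_elim
      case (elim x)
      show ?case
      proof
        assume n: "enat n \<le> \<nu> k x"
        have "D k i x = 0" if "i < n" for i
        proof -
          \<comment> \<open>Since i < n, the index i precedes the stopping time, so x is not in
            shell \<open>A k i\<close>.\<close>
          have "\<not> \<nu> k x \<le> enat i"
            using n that by (metis enat_ord_simps(2) leD order_trans)
          then show ?thesis by (simp add: \<nu>_le D_def A_def)
        qed
        with elim show "real_cond_exp M (F n) (a k) x = 0" by simp
      qed
    qed
  next
    let ?s = "sfun M F (\<lambda>n. real_cond_exp M (F n) (a k))"
    have "AE x in M. ?s x \<le> inverse (L k)"
    \<comment> \<open>If \<open>L k = 0\<close>, the bound is \<open>inverse 0\<close>, which is
      infinite.\<close>
    proof (cases "L k = 0")
      case False
      then obtain l where l: "L k = ennreal l" "0 < l"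
        using L_fin[of k] by (cases "L k") (auto simp: less_le)
      have \<mu>: "0 < \<mu> k" "\<mu> k = 2 powr (real_of_int k + 1) * l"
        using l by (auto simp: \<mu>_def)
      have "AE x in M. nn_cond_exp M (F i)
            (\<lambda>y. ennreal ((real_cond_exp M (F (Suc i)) (a k) y - real_cond_exp M (F i) (a k) y)\<^sup>2)) x
          = ennreal (1 / (\<mu> k)\<^sup>2) * (indicator (A k i) x * e i x)" for i
      proof -
        have eq: "AE x in M. ennreal ((real_cond_exp M (F (Suc i)) (a k) x - real_cond_exp M (F i) (a k) x)\<^sup>2)
            = (ennreal (1 / (\<mu> k)\<^sup>2) * indicator (A k i) x) * ennreal ((d i x)\<^sup>2)"
          using a_cond[of "Suc i" k] a_cond[of i k]
        proof eventually_elim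
          case (elim x)
          have "real_cond_exp M (F (Suc i)) (a k) x - real_cond_exp M (F i) (a k) x = D k i x / \<mu> k"
            unfolding elim by (simp flip: diff_divide_distrib)
          then show ?case
            by (simp add: D_def power_divide split: split_indicator flip: ennreal_mult)
        qed
        have "AE x in M. nn_cond_exp M (F i)
              (\<lambda>y. ennreal ((real_cond_exp M (F (Suc i)) (a k) y - real_cond_exp M (F i) (a k) y)\<^sup>2)) x
            = nn_cond_exp M (F i) (\<lambda>x. (ennreal (1 / (\<mu> k)\<^sup>2) * indicator (A k i) x) * ennreal ((d i x)\<^sup>2)) x"
          by (rule F.nn_cond_exp_cong[OF eq]) measurable
        moreover have "AE x in M. (ennreal (1 / (\<mu> k)\<^sup>2) * indicator (A k i) x) * e i x
            = nn_cond_exp M (F i) (\<lambda>x. (ennreal (1 / (\<mu> k)\<^sup>2) * indicator (A k i) x) * ennreal ((d i x)\<^sup>2)) x"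
          unfolding e_def by (rule F.nn_cond_exp_prod) (use A_sets in auto)
        ultimately show ?thesis
          by eventually_elim (simp add: mult.assoc)
      qed
      then have "AE x in M. \<forall>i. nn_cond_exp M (F i)
            (\<lambda>y. ennreal ((real_cond_exp M (F (Suc i)) (a k) y - real_cond_exp M (F i) (a k) y)\<^sup>2)) x
          = ennreal (1 / (\<mu> k)\<^sup>2) * (indicator (A k i) x * e i x)"
        by (simp add: AE_all_countable)
      then show ?thesis
      proof eventually_elim
        case (elim x)
        have "(\<Sum>i. nn_cond_exp M (F i)
            (\<lambda>y. ennreal ((real_cond_exp M (F (Suc i)) (a k) y - real_cond_exp M (F i) (a k) y)\<^sup>2)) x)
          = ennreal (1 / (\<mu> k)\<^sup>2) * (\<Sum>i. indicator (A k i) x * e i x)"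
          unfolding elim[rule_format] by (rule ennreal_suminf_cmult)
        also have "\<dots> \<le> ennreal (1 / (\<mu> k)\<^sup>2) * t (k + 1)"
          by (intro mult_left_mono A_sum) simp
        also have "\<dots> = (inverse (L k))\<^sup>2"
        proof -
          have "ennreal (1 / (\<mu> k)\<^sup>2) * t (k + 1) = ennreal (1 / (\<mu> k)\<^sup>2 * 4 powr (real_of_int k + 1))"
            unfolding t_def by (subst ennreal_mult) simp_all
          also have "1 / (\<mu> k)\<^sup>2 * 4 powr (real_of_int k + 1) = (inverse l)\<^sup>2"
            using l unfolding \<mu>(2) four_powr_eq by (simp add: power_mult_distrib field_simps)
          finally show ?thesis
            using l by (simp add: inverse_ennreal ennreal_power)
        qed
        finally have "?s x \<le> epow ((inverse (L k))\<^sup>2) (1/2)"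
          unfolding sfun_def by (rule epow_mono) simp
        then show ?case by (simp only: epow_power2_half)
      qed
    qed simp
    then show "AE x in M. x \<in> Bset M (\<nu> k) \<longrightarrow> ?s x \<le> inverse (lux M \<phi> (indicator (Bset M (\<nu> k))))"
      by eventually_elim (simp add: L_def B_def)
  qed

  have sfun_fin: "AE x in M. sfun M F f x < \<infinity>"
    using fin unfolding Hs_norm_def by (intro AE_finite_if_lux_finite) auto
  \<comment> \<open>Where s(f) is finite and \<open>S i x > 0\<close>, exactly one shell contains x
    at index i, so the sum over k has a single term. Where \<open>S i x = 0\<close>, also
    \<open>e i x = 0\<close>, and \<open>d i\<close> vanishes almost everywhere.\<close>
  have shells: "AE x in M. (\<lambda>N::nat. \<Sum>k\<in>{- int N..int N}. D k i x) \<longlonglongrightarrow> d i x" for i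
  proof -
    have "{x \<in> space M. S i x = 0} \<in> sets (F i)"
      using S_meas[of i] unfolding space_F[of i, symmetric] by measurable
    then have "AE x in M. x \<in> {x \<in> space M. S i x = 0} \<longrightarrow> ennreal ((d i x)\<^sup>2) = 0"
      by (rule AE_zero_if_nn_cond_exp_zero[rotated])
        (auto simp: S_def sum_nonneg_eq_0_iff simp flip: e_def)
    with sfun_fin AE_space show ?thesis
    proof eventually_elim
      case (elim x)
      have "(\<Sum>i. e i x) < \<infinity>"
        using elim(1) by (cases "(\<Sum>i. e i x) = \<infinity>") (auto simp: sfun_eq less_top)
      then have "S i x < \<infinity>"
        using S_le[of i x] by (rule le_less_trans[rotated])
      show ?case
      proof (cases "d i x = 0")
        case False
        with elim have "S i x \<noteq> 0" by auto
        with \<open>S i x < \<infinity>\<close> obtain s where s: "S i x = ennreal s" "0 < s"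
          by (cases "S i x") (auto simp: less_le)
        obtain m where m: "\<And>k. (4 powr real_of_int k < s \<and> s \<le> 4 powr (real_of_int k + 1)) \<longleftrightarrow> k = m"
          using dyadic_shell[OF s(2)] by blast
        have "x \<in> A k i \<longleftrightarrow> k = m" for k
          using m[of k] s elim(2) by (auto simp: A_def t_def ennreal_less_iff)
        then have D_eq: "D k i x = (if k = m then d i x else 0)" for k
          by (simp add: D_def indicator_def)
        have "\<forall>\<^sub>F N in sequentially. (\<Sum>k\<in>{- int N..int N}. D k i x) = d i x"
          using eventually_ge_at_top[of "nat \<bar>m\<bar>"]
        proof eventually_elim
          case (elim N)
          then have "m \<in> {- int N..int N}" by auto
          then show ?case by (simp add: D_eq sum.delta)
        qed
        then show ?thesis by (rule tendsto_eventually)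
      qed (simp add: D_def)
    qed
  qed
  have conv: "AE x in M. (\<lambda>N::nat. \<Sum>k\<in>{- int N..int N}. \<mu> k * real_cond_exp M (F n) (a k) x) \<longlonglongrightarrow> f n x" for n
  proof -
    have "AE x in M. \<mu> k * real_cond_exp M (F n) (a k) x = (\<Sum>i<n. D k i x)" for k
    \<comment> \<open>For a zero coefficient the left side is 0, and \<open>B k\<close>, which
      contains all shells of level k, is null.\<close>
    proof (cases "\<mu> k = 0")
      case True
      then have "AE x in M. x \<notin> B k"
        using AE_notin_if_lux_indicator_zero[OF \<phi> B_sets[of k]] by (simp add: \<mu>_zero L_def)
      then show ?thesis
      proof eventually_elim
        case (elim x)
        then have "D k i x = 0" for i
          using A_B[of k i] by (auto simp: D_def indicator_def)
        with True show ?case by simp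
      qed
    next
      case False
      from a_cond[of n k] show ?thesis
        by eventually_elim (use False in simp)
    qed
    then have "AE x in M. \<forall>k. \<mu> k * real_cond_exp M (F n) (a k) x = (\<Sum>i<n. D k i x)"
      by (simp add: AE_all_countable)
    moreover have "AE x in M. \<forall>i. (\<lambda>N::nat. \<Sum>k\<in>{- int N..int N}. D k i x) \<longlonglongrightarrow> d i x"
      using shells by (simp add: AE_all_countable)
    moreover have "AE x in M. f 0 x = 0"
      using f by (simp add: martingale0_def)
    ultimately show ?thesis
    proof eventually_elim
      case (elim x)
      have "(\<lambda>N::nat. \<Sum>i<n. \<Sum>k\<in>{- int N..int N}. D k i x) \<longlonglongrightarrow> (\<Sum>i<n. d i x)"
        using elim(2) by (intro tendsto_sum) auto
      moreover have "(\<Sum>i<n. d i x) = f n x"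
        using elim(3) sum_lessThan_telescope[of "\<lambda>i. f i x" n] by (simp add: d_def)
      moreover have "(\<Sum>i<n. \<Sum>k\<in>{- int N..int N}. D k i x)
          = (\<Sum>k\<in>{- int N..int N}. \<mu> k * real_cond_exp M (F n) (a k) x)" for N :: nat
        using elim(1) by (subst sum.swap) simp
      ultimately show ?case by simp
    qed
  qed
  have decomp: "at_decomp M F \<phi> f \<mu> a \<nu>"
    unfolding at_decomp_def using \<mu>_nonneg atom conv by blast

  define K where "K = 2 powr r / (1 - 2 powr (- r))"
  have K: "0 < K"
    using r by (simp add: K_def powr_less_one)
  have "at_value M \<phi> r \<mu> \<nu> \<le> lux M \<phi> (\<lambda>x. ennreal (K powr (1 / r)) * sfun M F f x)"
    unfolding at_value_def
  proof (rule lux_mono_AE[OF \<phi>])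
    show "AE x in M. epow (\<integral>\<^sup>+ k. epow (ennreal (\<mu> k) * indicator (Bset M (\<nu> k)) x
        / lux M \<phi> (indicator (Bset M (\<nu> k)))) r \<partial>count_space UNIV) (1 / r)
      \<le> ennreal (K powr (1 / r)) * sfun M F f x"
      using sfun_fin
    proof eventually_elim
      case (elim x)
      then obtain s where s: "sfun M F f x = ennreal s" "0 \<le> s"
        by (cases "sfun M F f x") auto
      \<comment> \<open>The norm \<open>L k\<close> cancels and leaves 2^(k+1). If
        \<open>L k = 0\<close>, then \<open>\<mu> k = 0\<close> as well, and 0/0 is 0 in
        \<open>ennreal\<close>.\<close>
      have term_le: "epow (ennreal (\<mu> k) * indicator (B k) x / L k) r
          \<le> ennreal ((2 powr (real_of_int k + 1)) powr r) * indicator {k. 2 powr real_of_int k < s} k" for k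
      proof (cases "x \<in> B k \<and> L k \<noteq> 0")
        case True
        then obtain l where l: "L k = ennreal l" "0 < l"
          using L_fin[of k] by (cases "L k") (auto simp: less_le)
        then have "ennreal (\<mu> k) * indicator (B k) x / L k = ennreal (2 powr (real_of_int k + 1))"
          using True by (simp add: \<mu>_def divide_ennreal)
        moreover have "2 powr real_of_int k < s"
          using True s by (auto simp: B_eq ennreal_less_iff)
        ultimately show ?thesis
          by (simp add: epow_ennreal)
      next
        case False
        then have "ennreal (\<mu> k) * indicator (B k) x / L k = 0"
          using \<mu>_zero[of k] by (auto simp: indicator_def)
        moreover have "epow 0 r = 0"
          using epow_ennreal[of 0 r] by simp
        ultimately show ?thesis by (simp only: zero_le)
      qed
      have "(\<integral>\<^sup>+ k. epow (ennreal (\<mu> k) * indicator (B k) x / L k) r \<partial>count_space UNIV)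
          \<le> (\<integral>\<^sup>+ k. ennreal ((2 powr (real_of_int k + 1)) powr r) * indicator {k. 2 powr real_of_int k < s} k \<partial>count_space UNIV)"
        by (intro nn_integral_mono term_le)
      also have "\<dots> \<le> ennreal (K * s powr r)"
        using nn_integral_dyadic_le[OF r s(2)] by (simp add: K_def)
      finally have "epow (\<integral>\<^sup>+ k. epow (ennreal (\<mu> k) * indicator (B k) x / L k) r \<partial>count_space UNIV) (1 / r)
          \<le> epow (ennreal (K * s powr r)) (1 / r)"
        using r by (intro epow_mono) auto
      also have "\<dots> = ennreal (K powr (1 / r)) * sfun M F f x"
        using r K s by (simp add: epow_ennreal powr_mult powr_powr flip: ennreal_mult)
      finally show ?case by (simp add: B_def L_def)
    qed
  qed
  also have "\<dots> \<le> ennreal (K powr (1 / r)) * Hs_norm M F \<phi> f"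
    unfolding Hs_norm_def using K by (intro lux_cmult_le) simp
  finally show thesis
    using that[OF decomp] by (simp add: K_def)
qed

end

section \<open>Equivalence of the two quasi-norms\<close>

theorem theorem4p1:
  fixes M :: "'a measure" and F :: "nat \<Rightarrow> 'a measure" and \<phi> :: "'a \<Rightarrow> real \<Rightarrow> real" and r :: real
  assumes "prob_space M"
    and "filtration_nat M F"
    and "musielak_orlicz M \<phi>"
    and "0 < r" and "r \<le> 1"
  shows "\<exists>C::real. C > 0 \<and> (\<forall>f. martingale0 M F f \<longrightarrow>
            (in_Hs M F \<phi> f \<longleftrightarrow> in_Hat M F \<phi> r f)
          \<and> Hat_norm M F \<phi> r f \<le> ennreal C * Hs_norm M F \<phi> f
          \<and> Hs_norm M F \<phi> f \<le> ennreal C * Hat_norm M F \<phi> r f)"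
proof -
  interpret filtered_prob_space M F
    using assms(1,2) by (simp add: filtered_prob_space_def filtered_prob_space_axioms_def)
  define K where "K = (2 powr r / (1 - 2 powr (- r))) powr (1 / r)"
  \<comment> \<open>One constant serves both directions: K, depending only on r, for building a
    decomposition, and 1 for estimating s(f) from a given one.\<close>
  define C where "C = max 1 K"
  have C: "1 \<le> C" "K \<le> C"
    by (auto simp: C_def)
  have "(in_Hs M F \<phi> f \<longleftrightarrow> in_Hat M F \<phi> r f)
      \<and> Hat_norm M F \<phi> r f \<le> ennreal C * Hs_norm M F \<phi> f
      \<and> Hs_norm M F \<phi> f \<le> ennreal C * Hat_norm M F \<phi> r f" if f: "martingale0 M F f" for f
  proof (intro conjI)
    note upper = Hs_norm_le_at_value[OF assms(3) f assms(4,5)]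
    have lower: "\<exists>\<mu> a \<nu>. at_decomp M F \<phi> f \<mu> a \<nu> \<and> at_value M \<phi> r \<mu> \<nu> \<le> ennreal C * Hs_norm M F \<phi> f"
      if fin: "Hs_norm M F \<phi> f < \<infinity>"
    proof -
      obtain \<mu> a \<nu> where dec: "at_decomp M F \<phi> f \<mu> a \<nu>"
        and "at_value M \<phi> r \<mu> \<nu> \<le> ennreal K * Hs_norm M F \<phi> f"
        using atomic_decomposition_exists[OF assms(3) f assms(4) fin] unfolding K_def by blast
      moreover have "ennreal K * Hs_norm M F \<phi> f \<le> ennreal C * Hs_norm M F \<phi> f"
        using C by (intro mult_right_mono ennreal_leI) auto
      ultimately show ?thesis by (blast intro: order_trans)
    qed
    show "in_Hs M F \<phi> f \<longleftrightarrow> in_Hat M F \<phi> r f"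
    proof
      assume "in_Hs M F \<phi> f"
      then have fin: "Hs_norm M F \<phi> f < \<infinity>" by (simp add: in_Hs_def)
      then have "ennreal C * Hs_norm M F \<phi> f < \<infinity>"
        by (simp add: ennreal_mult_less_top)
      with lower[OF fin] f show "in_Hat M F \<phi> r f"
        unfolding in_Hat_def by (blast intro: le_less_trans)
    next
      assume "in_Hat M F \<phi> r f"
      with f upper show "in_Hs M F \<phi> f"
        unfolding in_Hat_def in_Hs_def by (blast intro: le_less_trans)
    qed
    show "Hat_norm M F \<phi> r f \<le> ennreal C * Hs_norm M F \<phi> f"
    proof (cases "Hs_norm M F \<phi> f < \<infinity>")
      case True
      then obtain \<mu> a \<nu> where dec: "at_decomp M F \<phi> f \<mu> a \<nu>"
        and le: "at_value M \<phi> r \<mu> \<nu> \<le> ennreal C * Hs_norm M F \<phi> f"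
        using lower by blast
      have "Hat_norm M F \<phi> r f \<le> at_value M \<phi> r \<mu> \<nu>"
        unfolding Hat_norm_def using dec by (intro Inf_lower) blast
      with le show ?thesis by (rule order_trans[rotated])
    next
      case False
      then show ?thesis
        using C by (simp add: less_top[symmetric] ennreal_mult_top)
    qed
    \<comment> \<open>If f has no decomposition, the infimum on the right is infinite, so the bound
      holds for every martingale.\<close>
    have "Hs_norm M F \<phi> f \<le> Hat_norm M F \<phi> r f"
      unfolding Hat_norm_def using upper by (auto intro!: Inf_greatest)
    also have "\<dots> \<le> ennreal C * Hat_norm M F \<phi> r f"
      using mult_right_mono[of 1 "ennreal C" "Hat_norm M F \<phi> r f"] C by simp
    finally show "Hs_norm M F \<phi> f \<le> ennreal C * Hat_norm M F \<phi> r f" .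
  qed
  with C show ?thesis
    by (intro exI[of _ C]) auto
qed

end
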